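(* ($\mathsf{RCA}_0+\mathsf{I}\Sigma^0_2$) For every computable weakly rainbow-stable 2-bounded coloring $f:[\mathbb{N}]^2\to\mathbb{N}$ there exists a uniform family $(X_e)_{e\in\mathbb{N}}$ of $\Delta^0_2$ finite sets such that every $(X_e)_{e\in\mathbb{N}}$-escaping function computes an infinite $f$-rainbow.
   Context: The statement is asserted to be provable in $\mathsf{RCA}_0+\mathsf{I}\Sigma^0_2$, where $\mathsf{RCA}_0$ is the usual base system of reverse mathematics and $\mathsf{I}\Sigma^0_2$ is the induction scheme for $\Sigma^0_2$ formulas. A coloring $f:[\mathbb{N}]^2\to\mathbb{N}$ (defined on pairs $x<s$) is 2-bounded if $|f^{-1}(y)|\le2$ for every $y$. It is weakly rainbow-stable if for all $x,y$, either $f(x,s)=f(y,s)$ for all but finitely many $s$, or $f(x,s)\neq f(y,s)$ for all but finitely many $s$. A set $R$ is a rainbow for $f$ (an $f$-rainbow) if $f$ is injective on $[R]^2$. A uniform family of $\Delta^0_2$ finite sets is a sequence $(X_e)_{e\in\mathbb{N}}$ of finite sets such that the relation $x\in X_e$ is $\Delta^0_2$. An $(X_e)_{e\in\mathbb{N}}$-escaping function is a function $h:\mathbb{N}^2\to\mathbb{N}$ such that $(\forall e)(\forall n)[\,|X_e|\le n\rightarrow h(e,n)\notin X_e\,]$. *)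

theory Defs
  imports Main
begin

text \<open>
  Number variables are de Bruijn indices, set variables are names. Only formulas without set
  quantifiers are needed. A bounded quantifier is primitive; in \<open>BForall t \<phi>\<close> the bound \<open>t\<close>
  is read outside the scope of the quantifier.
\<close>

datatype l2_term =
    Var nat
  | Zero
  | One
  | Plus l2_term l2_term
  | Times l2_term l2_term

datatype l2_form =
    Equal l2_term l2_term
  | Less l2_term l2_term
  | Member l2_term nat
  | Neg l2_form
  | Conj l2_form l2_form
  | BForall l2_term l2_form
  | Forall l2_form
  | Exists l2_form

fun bounded_form :: "l2_form \<Rightarrow> bool" where
  "bounded_form (Equal s t) = True"
| "bounded_form (Less s t) = True"
| "bounded_form (Member t X) = True"
| "bounded_form (Neg \<phi>) = bounded_form \<phi>"
| "bounded_form (Conj \<phi> \<psi>) = (bounded_form \<phi> \<and> bounded_form \<psi>)"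
| "bounded_form (BForall t \<phi>) = bounded_form \<phi>"
| "bounded_form (Forall \<phi>) = False"
| "bounded_form (Exists \<phi>) = False"

inductive sigma_form :: "nat \<Rightarrow> l2_form \<Rightarrow> bool"
  and pi_form :: "nat \<Rightarrow> l2_form \<Rightarrow> bool" where
  "bounded_form \<phi> \<Longrightarrow> sigma_form 0 \<phi>"
| "bounded_form \<phi> \<Longrightarrow> pi_form 0 \<phi>"
| "pi_form k \<phi> \<Longrightarrow> sigma_form (Suc k) (Exists \<phi>)"
| "sigma_form k \<phi> \<Longrightarrow> pi_form (Suc k) (Forall \<phi>)"

text \<open>
  The first-order part of a structure is the whole type \<^typ>\<open>'a\<close>; it need not be the standard
  natural numbers. The field \<open>sets\<close> is the second-order part.
\<close>

record 'a l2_struct =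
  zero :: 'a
  one :: 'a
  add :: "'a \<Rightarrow> 'a \<Rightarrow> 'a"
  mul :: "'a \<Rightarrow> 'a \<Rightarrow> 'a"
  lt :: "'a \<Rightarrow> 'a \<Rightarrow> bool"
  sets :: "'a set set"

primrec val :: "'a l2_struct \<Rightarrow> (nat \<Rightarrow> 'a) \<Rightarrow> l2_term \<Rightarrow> 'a" where
  "val M \<rho> (Var i) = \<rho> i"
| "val M \<rho> Zero = zero M"
| "val M \<rho> One = one M"
| "val M \<rho> (Plus s t) = add M (val M \<rho> s) (val M \<rho> t)"
| "val M \<rho> (Times s t) = mul M (val M \<rho> s) (val M \<rho> t)"

primrec sat :: "'a l2_struct \<Rightarrow> (nat \<Rightarrow> 'a set) \<Rightarrow> (nat \<Rightarrow> 'a) \<Rightarrow> l2_form \<Rightarrow> bool" where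
  "sat M \<sigma> \<rho> (Equal s t) = (val M \<rho> s = val M \<rho> t)"
| "sat M \<sigma> \<rho> (Less s t) = lt M (val M \<rho> s) (val M \<rho> t)"
| "sat M \<sigma> \<rho> (Member t X) = (val M \<rho> t \<in> \<sigma> X)"
| "sat M \<sigma> \<rho> (Neg \<phi>) = (\<not> sat M \<sigma> \<rho> \<phi>)"
| "sat M \<sigma> \<rho> (Conj \<phi> \<psi>) = (sat M \<sigma> \<rho> \<phi> \<and> sat M \<sigma> \<rho> \<psi>)"
| "sat M \<sigma> \<rho> (BForall t \<phi>) = (\<forall>n. lt M n (val M \<rho> t) \<longrightarrow> sat M \<sigma> (case_nat n \<rho>) \<phi>)"
| "sat M \<sigma> \<rho> (Forall \<phi>) = (\<forall>n. sat M \<sigma> (case_nat n \<rho>) \<phi>)"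
| "sat M \<sigma> \<rho> (Exists \<phi>) = (\<exists>n. sat M \<sigma> (case_nat n \<rho>) \<phi>)"

text \<open>The set defined by \<open>\<phi>\<close> in its variable 0, the other variables being parameters.\<close>

definition defset :: "'a l2_struct \<Rightarrow> (nat \<Rightarrow> 'a set) \<Rightarrow> (nat \<Rightarrow> 'a) \<Rightarrow> l2_form \<Rightarrow> 'a set" where
  "defset M \<sigma> \<rho> \<phi> = {n. sat M \<sigma> (case_nat n \<rho>) \<phi>}"

definition basic_axioms :: "'a l2_struct \<Rightarrow> bool" where
  "basic_axioms M \<longleftrightarrow>
     (\<forall>n. add M n (one M) \<noteq> zero M) \<and>
     (\<forall>m n. add M m (one M) = add M n (one M) \<longrightarrow> m = n) \<and>
     (\<forall>m. add M m (zero M) = m) \<and>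
     (\<forall>m n. add M m (add M n (one M)) = add M (add M m n) (one M)) \<and>
     (\<forall>m. mul M m (zero M) = zero M) \<and>
     (\<forall>m n. mul M m (add M n (one M)) = add M (mul M m n) m) \<and>
     (\<forall>m. \<not> lt M m (zero M)) \<and>
     (\<forall>m n. lt M m (add M n (one M)) \<longleftrightarrow> lt M m n \<or> m = n)"

definition Sigma_induction :: "nat \<Rightarrow> 'a l2_struct \<Rightarrow> bool" where
  "Sigma_induction k M \<longleftrightarrow>
     (\<forall>\<phi> \<sigma> \<rho>. sigma_form k \<phi> \<and> range \<sigma> \<subseteq> sets M \<and>
        zero M \<in> defset M \<sigma> \<rho> \<phi> \<and>
        (\<forall>n. n \<in> defset M \<sigma> \<rho> \<phi> \<longrightarrow> add M n (one M) \<in> defset M \<sigma> \<rho> \<phi>) \<longrightarrow>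
        (\<forall>n. n \<in> defset M \<sigma> \<rho> \<phi>))"

definition Delta1_comprehension :: "'a l2_struct \<Rightarrow> bool" where
  "Delta1_comprehension M \<longleftrightarrow>
     (\<forall>\<phi> \<psi> \<sigma> \<rho>. sigma_form 1 \<phi> \<and> pi_form 1 \<psi> \<and> range \<sigma> \<subseteq> sets M \<and>
        defset M \<sigma> \<rho> \<phi> = defset M \<sigma> \<rho> \<psi> \<longrightarrow> defset M \<sigma> \<rho> \<phi> \<in> sets M)"

definition RCA0 :: "'a l2_struct \<Rightarrow> bool" where
  "RCA0 M \<longleftrightarrow> sets M \<noteq> {} \<and> basic_axioms M \<and> Sigma_induction 1 M \<and> Delta1_comprehension M"

text \<open>
  \<open>delta_in k Z M A\<close> is lightface definability of \<open>A\<close> relative to \<open>Z\<close>: the only set parameter is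
  \<open>Z\<close>. Number parameters are allowed, since an index is an arbitrary, possibly nonstandard,
  element of the structure.
\<close>

definition delta_in :: "nat \<Rightarrow> 'a set \<Rightarrow> 'a l2_struct \<Rightarrow> 'a set \<Rightarrow> bool" where
  "delta_in k Z M A \<longleftrightarrow>
     (\<exists>\<phi> \<rho>. sigma_form k \<phi> \<and> A = defset M (\<lambda>_. Z) \<rho> \<phi>) \<and>
     (\<exists>\<psi> \<rho>. pi_form k \<psi> \<and> A = defset M (\<lambda>_. Z) \<rho> \<psi>)"

abbreviation delta :: "nat \<Rightarrow> 'a l2_struct \<Rightarrow> 'a set \<Rightarrow> bool" where
  "delta k \<equiv> delta_in k {}"

definition computes :: "'a l2_struct \<Rightarrow> 'a set \<Rightarrow> 'a set \<Rightarrow> bool" where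
  "computes M Z A \<longleftrightarrow> delta_in 1 Z M A"

definition computable :: "'a l2_struct \<Rightarrow> 'a set \<Rightarrow> bool" where
  "computable M A \<longleftrightarrow> computes M {} A"

text \<open>The pairing \<open>(m + n)\<^sup>2 + m\<close>, which \<open>RCA0\<close> proves injective but not surjective.\<close>

definition pair :: "'a l2_struct \<Rightarrow> 'a \<Rightarrow> 'a \<Rightarrow> 'a" where
  "pair M m n = add M (mul M (add M m n) (add M m n)) m"

definition graph1 :: "'a l2_struct \<Rightarrow> 'a set \<Rightarrow> ('a \<Rightarrow> 'a) \<Rightarrow> 'a set" where
  "graph1 M D g = {pair M m (g m) | m. m \<in> D}"

definition graph2 :: "'a l2_struct \<Rightarrow> ('a \<times> 'a) set \<Rightarrow> ('a \<Rightarrow> 'a \<Rightarrow> 'a) \<Rightarrow> 'a set" where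
  "graph2 M D g = {pair M (pair M m n) (g m n) | m n. (m, n) \<in> D}"

text \<open>Finiteness in the sense of the structure, as usual in reverse mathematics.\<close>

definition finite_in :: "'a l2_struct \<Rightarrow> 'a set \<Rightarrow> bool" where
  "finite_in M A \<longleftrightarrow> (\<exists>b. \<forall>n\<in>A. lt M n b)"

text \<open>
  Cardinality in the sense of the structure: the bijection counting \<open>A\<close> must belong to the
  second-order part.
\<close>

definition has_card :: "'a l2_struct \<Rightarrow> 'a set \<Rightarrow> 'a \<Rightarrow> bool" where
  "has_card M A m \<longleftrightarrow>
     (\<exists>g. graph1 M {i. lt M i m} g \<in> sets M \<and> bij_betw g {i. lt M i m} A)"

definition card_le :: "'a l2_struct \<Rightarrow> 'a set \<Rightarrow> 'a \<Rightarrow> bool" where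
  "card_le M A n \<longleftrightarrow> (\<exists>m. (lt M m n \<or> m = n) \<and> has_card M A m)"

text \<open>
  A coloring of pairs is a function \<open>f\<close> of two arguments of which only the values \<open>f x s\<close>
  with \<open>x < s\<close> are relevant.
\<close>

definition pairs_of :: "'a l2_struct \<Rightarrow> 'a set \<Rightarrow> ('a \<times> 'a) set" where
  "pairs_of M R = {(x, s). x \<in> R \<and> s \<in> R \<and> lt M x s}"

definition computable_coloring :: "'a l2_struct \<Rightarrow> ('a \<Rightarrow> 'a \<Rightarrow> 'a) \<Rightarrow> bool" where
  "computable_coloring M f \<longleftrightarrow> computable M (graph2 M (pairs_of M UNIV) f)"

definition two_bounded :: "'a l2_struct \<Rightarrow> ('a \<Rightarrow> 'a \<Rightarrow> 'a) \<Rightarrow> bool" where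
  "two_bounded M f \<longleftrightarrow>
     (\<forall>y. let P = {(x, s) \<in> pairs_of M UNIV. f x s = y} in finite P \<and> card P \<le> 2)"

definition weakly_rainbow_stable :: "'a l2_struct \<Rightarrow> ('a \<Rightarrow> 'a \<Rightarrow> 'a) \<Rightarrow> bool" where
  "weakly_rainbow_stable M f \<longleftrightarrow>
     (\<forall>x y. finite_in M {s. lt M x s \<and> lt M y s \<and> f x s \<noteq> f y s} \<or>
            finite_in M {s. lt M x s \<and> lt M y s \<and> f x s = f y s})"

definition rainbow :: "'a l2_struct \<Rightarrow> ('a \<Rightarrow> 'a \<Rightarrow> 'a) \<Rightarrow> 'a set \<Rightarrow> bool" where
  "rainbow M f R \<longleftrightarrow> inj_on (\<lambda>(x, s). f x s) (pairs_of M R)"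

definition delta2_finite_family :: "'a l2_struct \<Rightarrow> ('a \<Rightarrow> 'a set) \<Rightarrow> bool" where
  "delta2_finite_family M X \<longleftrightarrow>
     (\<forall>e. finite_in M (X e)) \<and> delta 2 M {pair M x e | x e. x \<in> X e}"

definition escaping :: "'a l2_struct \<Rightarrow> ('a \<Rightarrow> 'a set) \<Rightarrow> ('a \<Rightarrow> 'a \<Rightarrow> 'a) \<Rightarrow> bool" where
  "escaping M X h \<longleftrightarrow> (\<forall>e n. card_le M (X e) n \<longrightarrow> h e n \<notin> X e)"

end

theory Submission
  imports Defs
begin

text \<open>
  Call \<open>x\<close> and \<open>y\<close> partners if \<open>f x s = f y s\<close> for almost all \<open>s\<close>. Weak rainbow-stability makes this
  relation \<open>\<Delta>\<^sub>2\<close>, and 2-boundedness gives every number at most one partner besides itself. Let \<open>X e\<close> be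
  the set of those \<open>v\<close> for which the pair \<open>(e, v)\<close> has a partner below \<open>e\<close>; it injects into \<open>e\<close>, so
  the value \<open>h e e\<close> of an escaping function lies outside \<open>X e\<close> and the number
  \<open>key e = (e, h e e) \<ge> e\<close> has no partner below \<open>e\<close>. A rainbow is now built greedily: select
  \<open>x = key e\<close> if \<open>e\<close> exceeds all numbers selected so far and \<open>x\<close> produces no repeated color. No two
  selected numbers are partners, so for every finite set of selected numbers almost every \<open>key e\<close> is
  admissible.

  In a nonstandard model, finite sets and recursion have to be coded by numbers, and \<open>\<Sigma>\<^sub>2\<close>-induction
  serves to see that \<open>X e\<close> belongs to the model with a counting bijection, and, as
  \<open>\<Sigma>\<^sub>2\<close>-collection, to find a common bound for the exceptions to the "almost all" clauses.
\<close>

section \<open>Semantic definability\<close>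

text \<open>The partner relation is only \<open>\<Delta>\<^sub>2\<close>, so a rainbow computable
  from \<open>h\<close> cannot consult it. The greedy test therefore looks only at colors of pairs
  with entries up to \<open>x\<close>; partners enter solely in the argument that the construction
  never gets stuck. That argument needs a new number without partners among all numbers selected
  before, which is why the index \<open>e\<close> has to exceed them. Packing \<open>e\<close> into
  the candidate serves two purposes. A candidate \<open>pair M e v\<close> is at least
  \<open>e\<close> and so differs from every \<open>y \<prec> e\<close>; hence each \<open>y\<close>
  rules out at most one \<open>v\<close>, and \<open>e\<close> bounds the cardinality. Moreover,
  \<open>e\<close> can be searched for below \<open>x\<close>, so the test is decidable. The
  counting bijection has to be a set of the model although it counts a
  \<open>\<Delta>\<^sub>2\<close> relation. The relation is first replaced by a number that codes
  its restriction to a bounded range. Complexity bounds are proved for predicates on environments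
  instead of formulas, with negations in place of \<open>\<Pi>\<close> classes, so that they reduce
  to introduction rules.\<close>

primrec ren_term :: "(nat \<Rightarrow> nat) \<Rightarrow> l2_term \<Rightarrow> l2_term" where
  "ren_term r (Var i) = Var (r i)"
| "ren_term r Zero = Zero"
| "ren_term r One = One"
| "ren_term r (Plus s t) = Plus (ren_term r s) (ren_term r t)"
| "ren_term r (Times s t) = Times (ren_term r s) (ren_term r t)"

primrec ren_form :: "(nat \<Rightarrow> nat) \<Rightarrow> l2_form \<Rightarrow> l2_form" where
  "ren_form r (Equal s t) = Equal (ren_term r s) (ren_term r t)"
| "ren_form r (Less s t) = Less (ren_term r s) (ren_term r t)"
| "ren_form r (Member t X) = Member (ren_term r t) X"
| "ren_form r (Neg \<phi>) = Neg (ren_form r \<phi>)"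
| "ren_form r (Conj \<phi> \<psi>) = Conj (ren_form r \<phi>) (ren_form r \<psi>)"
| "ren_form r (BForall t \<phi>) = BForall (ren_term r t) (ren_form (case_nat 0 (Suc \<circ> r)) \<phi>)"
| "ren_form r (Forall \<phi>) = Forall (ren_form (case_nat 0 (Suc \<circ> r)) \<phi>)"
| "ren_form r (Exists \<phi>) = Exists (ren_form (case_nat 0 (Suc \<circ> r)) \<phi>)"

lemma val_ren [simp]: "val M \<rho> (ren_term r t) = val M (\<rho> \<circ> r) t"
  by (induction t) auto

lemma case_nat_ren: "case_nat n \<rho> \<circ> case_nat 0 (Suc \<circ> r) = case_nat n (\<rho> \<circ> r)"
  by (auto simp: fun_eq_iff split: nat.split)

lemma sat_ren [simp]: "sat M \<sigma> \<rho> (ren_form r \<phi>) = sat M \<sigma> (\<rho> \<circ> r) \<phi>"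
  by (induction \<phi> arbitrary: \<rho> r) (auto simp: case_nat_ren)

lemma bounded_form_ren: "bounded_form (ren_form r \<phi>) = bounded_form \<phi>"
  by (induction \<phi> arbitrary: r) auto

lemma sigma_pi_form_ren:
  "(sigma_form k \<phi> \<longrightarrow> (\<forall>r. sigma_form k (ren_form r \<phi>))) \<and>
   (pi_form k \<psi> \<longrightarrow> (\<forall>r. pi_form k (ren_form r \<psi>)))"
  by (rule sigma_form_pi_form.induct)
     (auto simp: bounded_form_ren intro: sigma_form_pi_form.intros)

lemma sigma_form_0 [simp]: "sigma_form 0 \<phi> \<longleftrightarrow> bounded_form \<phi>"
  by (auto elim: sigma_form.cases intro: sigma_form_pi_form.intros)

lemma pi_form_0 [simp]: "pi_form 0 \<phi> \<longleftrightarrow> bounded_form \<phi>"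
  by (auto elim: pi_form.cases intro: sigma_form_pi_form.intros)

lemma sigma_form_Suc: "sigma_form (Suc k) \<phi> \<longleftrightarrow> (\<exists>\<psi>. \<phi> = Exists \<psi> \<and> pi_form k \<psi>)"
  by (auto elim: sigma_form.cases intro: sigma_form_pi_form.intros)

lemma sigma_pi_form_neg:
  "(sigma_form k \<phi> \<longrightarrow> (\<exists>\<chi>. pi_form k \<chi> \<and> (\<forall>M :: 'a l2_struct. \<forall>\<sigma> \<rho>. sat M \<sigma> \<rho> \<chi> = (\<not> sat M \<sigma> \<rho> \<phi>)))) \<and>
   (pi_form k \<psi> \<longrightarrow> (\<exists>\<chi>. sigma_form k \<chi> \<and> (\<forall>M :: 'a l2_struct. \<forall>\<sigma> \<rho>. sat M \<sigma> \<rho> \<chi> = (\<not> sat M \<sigma> \<rho> \<psi>))))"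
proof (induction rule: sigma_form_pi_form.induct)
  case (1 \<phi>)
  then show ?case by (intro exI[of _ "Neg \<phi>"]) auto
next
  case (2 \<phi>)
  then show ?case by (intro exI[of _ "Neg \<phi>"]) auto
next
  case (3 k \<phi>)
  then obtain \<chi> where "sigma_form k \<chi>"
    "\<forall>M :: 'a l2_struct. \<forall>\<sigma> \<rho>. sat M \<sigma> \<rho> \<chi> = (\<not> sat M \<sigma> \<rho> \<phi>)" by blast
  then show ?case by (intro exI[of _ "Forall \<chi>"]) (auto intro: sigma_form_pi_form.intros)
next
  case (4 k \<phi>)
  then obtain \<chi> where "pi_form k \<chi>"
    "\<forall>M :: 'a l2_struct. \<forall>\<sigma> \<rho>. sat M \<sigma> \<rho> \<chi> = (\<not> sat M \<sigma> \<rho> \<phi>)" by blast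
  then show ?case by (intro exI[of _ "Exists \<chi>"]) (auto intro: sigma_form_pi_form.intros)
qed

text \<open>
  A predicate on environments is definable if it is the truth of a formula in an environment each
  entry of which is either a fixed parameter or an entry of the given environment. In this form
  substitution of parameters and renaming of variables are the same operation.
\<close>

definition inst :: "(nat \<Rightarrow> 'a + nat) \<Rightarrow> (nat \<Rightarrow> 'a) \<Rightarrow> nat \<Rightarrow> 'a" where
  "inst s \<rho> i = (case s i of Inl c \<Rightarrow> c | Inr j \<Rightarrow> \<rho> j)"

lemma inst_ren: "inst s (\<rho> \<circ> r) = inst (map_sum id r \<circ> s) \<rho>"
  by (auto simp: inst_def fun_eq_iff split: sum.split)

text \<open>Two formulas come with two assignments of parameters. Interleaving these at even and odd
  positions gives one assignment over which both formulas can be renamed, as a binary connective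
  requires.\<close>

lemma inst_join:
  obtains s :: "nat \<Rightarrow> 'a + nat" and r1 r2 where
    "\<And>\<rho>. inst s1 \<rho> = inst s \<rho> \<circ> r1" "\<And>\<rho>. inst s2 \<rho> = inst s \<rho> \<circ> r2"
proof
  let ?s = "\<lambda>i. if even i then s1 (i div 2) else s2 (i div 2)"
  show "inst s1 \<rho> = inst ?s \<rho> \<circ> (\<lambda>i. 2 * i)" for \<rho> :: "nat \<Rightarrow> 'a"
    by (auto simp: inst_def fun_eq_iff)
  show "inst s2 \<rho> = inst ?s \<rho> \<circ> (\<lambda>i. Suc (2 * i))" for \<rho> :: "nat \<Rightarrow> 'a"
    by (auto simp: inst_def fun_eq_iff)
qed

text \<open>A quantifier binds variable 0 only, whereas \<open>s\<close> may refer to the entry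
  \<open>x\<close> at many positions; the renaming \<open>r\<close> sends all of them to 0.\<close>

lemma inst_bind:
  fixes s :: "nat \<Rightarrow> 'a + nat"
  obtains s' :: "nat \<Rightarrow> 'a + nat" and r where "\<And>x \<rho>. inst s (case_nat x \<rho>) = case_nat x (inst s' \<rho>) \<circ> r"
proof
  fix x :: 'a and \<rho> :: "nat \<Rightarrow> 'a"
  let ?s' = "\<lambda>i. case s i of Inl c \<Rightarrow> Inl c | Inr j \<Rightarrow> Inr (j - 1)"
  let ?r = "\<lambda>i. if s i = Inr 0 then 0 else Suc i"
  show "inst s (case_nat x \<rho>) = case_nat x (inst ?s' \<rho>) \<circ> ?r"
    by (auto simp: inst_def fun_eq_iff split: sum.split nat.split)
qed

lemma inst_unbind:
  fixes s :: "nat \<Rightarrow> 'a + nat"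
  obtains s' :: "nat \<Rightarrow> 'a + nat" where "\<And>x \<rho>. case_nat x (inst s \<rho>) = inst s' (case_nat x \<rho>)"
proof
  fix x :: 'a and \<rho> :: "nat \<Rightarrow> 'a"
  show "case_nat x (inst s \<rho>) = inst (case_nat (Inr 0) (map_sum id Suc \<circ> s)) (case_nat x \<rho>)"
    by (auto simp: inst_def fun_eq_iff split: sum.split nat.split)
qed

section \<open>Definable terms and predicates\<close>

definition trm :: "'a l2_struct \<Rightarrow> ((nat \<Rightarrow> 'a) \<Rightarrow> 'a) \<Rightarrow> bool" where
  "trm M t \<longleftrightarrow> (\<exists>u s. \<forall>\<rho>. t \<rho> = val M (inst s \<rho>) u)"

text \<open>Every set variable is interpreted by \<open>Z\<close>, which makes \<open>Z\<close> the
  only set parameter. A \<open>\<Pi>\<close> predicate is one whose negation satisfies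
  \<open>sigma\<close>.\<close>

definition sigma :: "'a l2_struct \<Rightarrow> 'a set \<Rightarrow> nat \<Rightarrow> ((nat \<Rightarrow> 'a) \<Rightarrow> bool) \<Rightarrow> bool" where
  "sigma M Z k P \<longleftrightarrow> (\<exists>\<phi> s. sigma_form k \<phi> \<and> (\<forall>\<rho>. P \<rho> = sat M (\<lambda>_. Z) (inst s \<rho>) \<phi>))"

lemma trm_var: "trm M (\<lambda>\<rho>. \<rho> i)"
  unfolding trm_def by (intro exI[of _ "Var 0"] exI[of _ "\<lambda>_. Inr i"]) (simp add: inst_def)

lemma trm_const: "trm M (\<lambda>\<rho>. c)"
  unfolding trm_def by (intro exI[of _ "Var 0"] exI[of _ "\<lambda>_. Inl c"]) (simp add: inst_def)

lemma trm_ren: "trm M t \<Longrightarrow> trm M (\<lambda>\<rho>. t (\<lambda>i. \<rho> (r i)))"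
  unfolding trm_def by (metis inst_ren[unfolded comp_def])

lemma trm_join:
  assumes "trm M t1" "trm M t2"
  obtains u1 u2 s where "\<And>\<rho>. t1 \<rho> = val M (inst s \<rho>) u1" "\<And>\<rho>. t2 \<rho> = val M (inst s \<rho>) u2"
proof -
  obtain u1 s1 u2 s2 where u: "\<And>\<rho>. t1 \<rho> = val M (inst s1 \<rho>) u1" "\<And>\<rho>. t2 \<rho> = val M (inst s2 \<rho>) u2"
    using assms unfolding trm_def by metis
  obtain s r1 r2 where "\<And>\<rho>. inst s1 \<rho> = inst s \<rho> \<circ> r1" "\<And>\<rho>. inst s2 \<rho> = inst s \<rho> \<circ> r2"
    by (rule inst_join, rule that)
  with u have "\<And>\<rho>. t1 \<rho> = val M (inst s \<rho>) (ren_term r1 u1)" "\<And>\<rho>. t2 \<rho> = val M (inst s \<rho>) (ren_term r2 u2)"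
    by simp_all
  then show thesis by (rule that)
qed

lemma trm_add: assumes "trm M t1" "trm M t2" shows "trm M (\<lambda>\<rho>. add M (t1 \<rho>) (t2 \<rho>))"
proof -
  obtain u1 u2 s where "\<And>\<rho>. t1 \<rho> = val M (inst s \<rho>) u1" "\<And>\<rho>. t2 \<rho> = val M (inst s \<rho>) u2"
    by (rule trm_join[OF assms], rule that)
  then show ?thesis unfolding trm_def by (intro exI[of _ "Plus u1 u2"] exI[of _ s]) simp
qed

lemma trm_mul: assumes "trm M t1" "trm M t2" shows "trm M (\<lambda>\<rho>. mul M (t1 \<rho>) (t2 \<rho>))"
proof -
  obtain u1 u2 s where "\<And>\<rho>. t1 \<rho> = val M (inst s \<rho>) u1" "\<And>\<rho>. t2 \<rho> = val M (inst s \<rho>) u2"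
    by (rule trm_join[OF assms], rule that)
  then show ?thesis unfolding trm_def by (intro exI[of _ "Times u1 u2"] exI[of _ s]) simp
qed

lemma trm_pair: "trm M t1 \<Longrightarrow> trm M t2 \<Longrightarrow> trm M (\<lambda>\<rho>. pair M (t1 \<rho>) (t2 \<rho>))"
  unfolding pair_def by (intro trm_add trm_mul)

lemma sigma_ren: "sigma M Z k P \<Longrightarrow> sigma M Z k (\<lambda>\<rho>. P (\<lambda>i. \<rho> (r i)))"
  unfolding sigma_def by (metis inst_ren[unfolded comp_def])

lemma sigma_0_eq: assumes "trm M t1" "trm M t2" shows "sigma M Z 0 (\<lambda>\<rho>. t1 \<rho> = t2 \<rho>)"
proof -
  obtain u1 u2 s where "\<And>\<rho>. t1 \<rho> = val M (inst s \<rho>) u1" "\<And>\<rho>. t2 \<rho> = val M (inst s \<rho>) u2"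
    by (rule trm_join[OF assms], rule that)
  then show ?thesis unfolding sigma_def by (intro exI[of _ "Equal u1 u2"] exI[of _ s]) simp
qed

lemma sigma_0_lt: assumes "trm M t1" "trm M t2" shows "sigma M Z 0 (\<lambda>\<rho>. lt M (t1 \<rho>) (t2 \<rho>))"
proof -
  obtain u1 u2 s where "\<And>\<rho>. t1 \<rho> = val M (inst s \<rho>) u1" "\<And>\<rho>. t2 \<rho> = val M (inst s \<rho>) u2"
    by (rule trm_join[OF assms], rule that)
  then show ?thesis unfolding sigma_def by (intro exI[of _ "Less u1 u2"] exI[of _ s]) simp
qed

lemma sigma_0_mem: "trm M t \<Longrightarrow> sigma M Z 0 (\<lambda>\<rho>. t \<rho> \<in> Z)"
  unfolding trm_def sigma_def by (metis bounded_form.simps(3) sat.simps(3) sigma_form_0)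

lemma sigma_0_not: "sigma M Z 0 P \<Longrightarrow> sigma M Z 0 (\<lambda>\<rho>. \<not> P \<rho>)"
  unfolding sigma_def by (metis bounded_form.simps(4) sat.simps(4) sigma_form_0)

lemma sigma_0_conj:
  assumes "sigma M Z 0 P" "sigma M Z 0 Q"
  shows "sigma M Z 0 (\<lambda>\<rho>. P \<rho> \<and> Q \<rho>)"
proof -
  obtain \<phi>1 s1 \<phi>2 s2 where \<phi>: "bounded_form \<phi>1" "bounded_form \<phi>2"
    "\<And>\<rho>. P \<rho> = sat M (\<lambda>_. Z) (inst s1 \<rho>) \<phi>1" "\<And>\<rho>. Q \<rho> = sat M (\<lambda>_. Z) (inst s2 \<rho>) \<phi>2"
    using assms unfolding sigma_def by auto
  obtain s r1 r2 where "\<And>\<rho>. inst s1 \<rho> = inst s \<rho> \<circ> r1" "\<And>\<rho>. inst s2 \<rho> = inst s \<rho> \<circ> r2"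
    by (rule inst_join, rule that)
  with \<phi> show ?thesis unfolding sigma_def
    by (intro exI[of _ "Conj (ren_form r1 \<phi>1) (ren_form r2 \<phi>2)"] exI[of _ s]) (simp add: bounded_form_ren)
qed

text \<open>In the premise the bound variable occupies position 0 and the environment moves up by
  one. With \<open>P\<close> a function of both, higher-order unification does the de Bruijn
  bookkeeping whenever this rule is applied.\<close>

lemma sigma_0_ball:
  assumes "trm M t" "sigma M Z 0 (\<lambda>\<rho>. P (\<rho> 0) (\<lambda>i. \<rho> (Suc i)))"
  shows "sigma M Z 0 (\<lambda>\<rho>. \<forall>x. lt M x (t \<rho>) \<longrightarrow> P x \<rho>)"
proof -
  obtain u s1 \<phi> s2 where \<phi>: "\<And>\<rho>. t \<rho> = val M (inst s1 \<rho>) u" "bounded_form \<phi>"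
    "\<And>\<rho>. P (\<rho> 0) (\<lambda>i. \<rho> (Suc i)) = sat M (\<lambda>_. Z) (inst s2 \<rho>) \<phi>"
    using assms unfolding sigma_def trm_def by auto
  obtain s3 r where r: "\<And>x \<rho>. inst s2 (case_nat x \<rho>) = case_nat x (inst s3 \<rho>) \<circ> r"
    by (rule inst_bind, rule that)
  obtain s r1 r2 where s: "\<And>\<rho>. inst s1 \<rho> = inst s \<rho> \<circ> r1" "\<And>\<rho>. inst s3 \<rho> = inst s \<rho> \<circ> r2"
    by (rule inst_join, rule that)
  have "P x \<rho> = sat M (\<lambda>_. Z) (case_nat x (inst s \<rho> \<circ> r2)) (ren_form r \<phi>)" for x \<rho>
    using \<phi>(3)[of "case_nat x \<rho>"] by (simp add: r s)
  with \<phi> s show ?thesis unfolding sigma_def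
    by (intro exI[of _ "BForall (ren_term r1 u) (ren_form (case_nat 0 (Suc \<circ> r2)) (ren_form r \<phi>))"] exI[of _ s])
       (simp add: bounded_form_ren case_nat_ren)
qed

lemma sigma_Suc_ex:
  assumes "sigma M Z k (\<lambda>\<rho>. \<not> P (\<rho> 0) (\<lambda>i. \<rho> (Suc i)))"
  shows "sigma M Z (Suc k) (\<lambda>\<rho>. \<exists>x. P x \<rho>)"
proof -
  obtain \<phi> s where \<phi>: "sigma_form k \<phi>" 
    "\<And>\<rho>. (\<not> P (\<rho> 0) (\<lambda>i. \<rho> (Suc i))) = sat M (\<lambda>_. Z) (inst s \<rho>) \<phi>"
    using assms unfolding sigma_def by auto
  obtain \<chi> where \<chi>: "pi_form k \<chi>" "\<And>\<sigma> \<rho>. sat M \<sigma> \<rho> \<chi> = (\<not> sat M \<sigma> \<rho> \<phi>)"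
    using sigma_pi_form_neg \<phi>(1) by metis
  obtain s' r where r: "\<And>x \<rho>. inst s (case_nat x \<rho>) = case_nat x (inst s' \<rho>) \<circ> r"
    by (rule inst_bind, rule that)
  have "P x \<rho> = sat M (\<lambda>_. Z) (case_nat x (inst s' \<rho>)) (ren_form r \<chi>)" for x \<rho>
    using \<phi>(2)[of "case_nat x \<rho>"] by (auto simp: r \<chi>)
  moreover have "sigma_form (Suc k) (Exists (ren_form r \<chi>))"
    using sigma_pi_form_ren[of k \<phi> \<chi>] \<chi>(1) by (auto simp: sigma_form_Suc)
  ultimately show ?thesis unfolding sigma_def
    by (intro exI[of _ "Exists (ren_form r \<chi>)"] exI[of _ s']) simp
qed

text \<open>A \<open>sigma_form (Suc k)\<close> literally starts with an existential quantifier.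
  Stripping it off reduces closure properties of level \<open>Suc k\<close> to those of level
  \<open>k\<close>.\<close>

lemma sigma_SucE:
  assumes "sigma M Z (Suc k) P"
  obtains Q where "sigma M Z k (\<lambda>\<rho>. \<not> Q (\<rho> 0) (\<lambda>i. \<rho> (Suc i)))" "P = (\<lambda>\<rho>. \<exists>x. Q x \<rho>)"
proof -
  obtain \<psi> s where \<psi>: "pi_form k \<psi>" "\<And>\<rho>. P \<rho> = (\<exists>x. sat M (\<lambda>_. Z) (case_nat x (inst s \<rho>)) \<psi>)"
    using assms unfolding sigma_def by (auto simp: sigma_form_Suc)
  obtain \<chi> where \<chi>: "sigma_form k \<chi>" "\<And>\<sigma> \<rho>. sat M \<sigma> \<rho> \<chi> = (\<not> sat M \<sigma> \<rho> \<psi>)"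
    using sigma_pi_form_neg \<psi>(1) by metis
  obtain s' where s': "\<And>x \<rho>. case_nat x (inst s \<rho>) = inst s' (case_nat x \<rho>)"
    by (rule inst_unbind, rule that)
  let ?Q = "\<lambda>x \<rho>. sat M (\<lambda>_. Z) (inst s' (case_nat x \<rho>)) \<psi>"
  have env: "case_nat (\<rho> 0) (\<lambda>i. \<rho> (Suc i)) = \<rho>" for \<rho> :: "nat \<Rightarrow> 'a"
    by (auto simp: fun_eq_iff split: nat.split)
  have "sigma M Z k (\<lambda>\<rho>. \<not> ?Q (\<rho> 0) (\<lambda>i. \<rho> (Suc i)))"
    unfolding sigma_def using \<chi> by (intro exI[of _ \<chi>] exI[of _ s']) (simp add: env)
  moreover have "P = (\<lambda>\<rho>. \<exists>x. ?Q x \<rho>)" by (auto simp: \<psi> s' fun_eq_iff)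
  ultimately show thesis by (rule that)
qed

lemma sigma_induct:
  assumes "Sigma_induction k M" "Z \<in> sets M" "sigma M Z k (\<lambda>\<rho>. P (\<rho> 0))"
    and "P (zero M)" "\<And>n. P n \<Longrightarrow> P (add M n (one M))"
  shows "P n"
proof -
  obtain \<phi> s where \<phi>: "sigma_form k \<phi>" "\<And>\<rho>. P (\<rho> 0) = sat M (\<lambda>_. Z) (inst s \<rho>) \<phi>"
    using assms(3) unfolding sigma_def by auto
  obtain s' r where r: "\<And>x \<rho>. inst s (case_nat x \<rho>) = case_nat x (inst s' \<rho>) \<circ> r"
    by (rule inst_bind, rule that)
  define \<pi> where "\<pi> = inst s' (\<lambda>_. zero M)"
  have eq: "P x = (x \<in> defset M (\<lambda>_. Z) \<pi> (ren_form r \<phi>))" for x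
    using \<phi>(2)[of "case_nat x (\<lambda>_. zero M)"] by (simp add: r defset_def \<pi>_def)
  have "sigma_form k (ren_form r \<phi>)" using sigma_pi_form_ren[of k \<phi>] \<phi>(1) by auto
  moreover have "range (\<lambda>_ :: nat. Z) \<subseteq> sets M" using assms(2) by auto
  ultimately show ?thesis
    using assms(1)[unfolded Sigma_induction_def, rule_format, of "ren_form r \<phi>" "\<lambda>_. Z" \<pi> n] assms(4,5)
    unfolding eq by blast
qed

lemma sigma_defset:
  assumes "sigma M Z k (\<lambda>\<rho>. \<rho> 0 \<in> A)"
  obtains \<phi> \<rho> where "sigma_form k \<phi>" "A = defset M (\<lambda>_. Z) \<rho> \<phi>"
proof -
  obtain \<phi> s where \<phi>: "sigma_form k \<phi>" "\<And>\<rho>. (\<rho> 0 \<in> A) = sat M (\<lambda>_. Z) (inst s \<rho>) \<phi>"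
    using assms unfolding sigma_def by auto
  obtain s' r where r: "\<And>x \<rho>. inst s (case_nat x \<rho>) = case_nat x (inst s' \<rho>) \<circ> r"
    by (rule inst_bind, rule that)
  have "(x \<in> A) = (x \<in> defset M (\<lambda>_. Z) (inst s' (\<lambda>_. zero M)) (ren_form r \<phi>))" for x
    using \<phi>(2)[of "case_nat x (\<lambda>_. zero M)"] by (simp add: r defset_def)
  moreover have "sigma_form k (ren_form r \<phi>)" using sigma_pi_form_ren[of k \<phi>] \<phi>(1) by auto
  ultimately show thesis using that by blast
qed

lemma pi_defset:
  assumes "sigma M Z k (\<lambda>\<rho>. \<rho> 0 \<notin> A)"
  obtains \<phi> \<rho> where "pi_form k \<phi>" "A = defset M (\<lambda>_. Z) \<rho> \<phi>"
proof -
  obtain \<phi> \<rho> where \<phi>: "sigma_form k \<phi>" "- A = defset M (\<lambda>_. Z) \<rho> \<phi>"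
    using assms by (auto intro: sigma_defset[of M Z k "- A"])
  obtain \<chi> where "pi_form k \<chi>" "\<And>\<sigma> \<rho>. sat M \<sigma> \<rho> \<chi> = (\<not> sat M \<sigma> \<rho> \<phi>)"
    using sigma_pi_form_neg \<phi>(1) by metis
  with \<phi>(2) have "A = defset M (\<lambda>_. Z) \<rho> \<chi>" by (auto simp: defset_def)
  with \<open>pi_form k \<chi>\<close> show thesis by (rule that)
qed

text \<open>Allows a lightface definition to be used alongside the set parameter \<open>Z\<close>.\<close>

primrec drop_members :: "l2_form \<Rightarrow> l2_form" where
  "drop_members (Equal s t) = Equal s t"
| "drop_members (Less s t) = Less s t"
| "drop_members (Member t X) = Neg (Equal Zero Zero)"
| "drop_members (Neg \<phi>) = Neg (drop_members \<phi>)"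
| "drop_members (Conj \<phi> \<psi>) = Conj (drop_members \<phi>) (drop_members \<psi>)"
| "drop_members (BForall t \<phi>) = BForall t (drop_members \<phi>)"
| "drop_members (Forall \<phi>) = Forall (drop_members \<phi>)"
| "drop_members (Exists \<phi>) = Exists (drop_members \<phi>)"

lemma sat_drop_members: "sat M \<sigma> \<rho> (drop_members \<phi>) = sat M (\<lambda>_. {}) \<rho> \<phi>"
  by (induction \<phi> arbitrary: \<rho>) auto

lemma bounded_form_drop_members: "bounded_form \<phi> \<Longrightarrow> bounded_form (drop_members \<phi>)"
  by (induction \<phi>) auto

lemma sigma_pi_form_drop_members:
  "(sigma_form k \<phi> \<longrightarrow> sigma_form k (drop_members \<phi>)) \<and> (pi_form k \<psi> \<longrightarrow> pi_form k (drop_members \<psi>))"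
  by (rule sigma_form_pi_form.induct)
     (auto simp: bounded_form_drop_members intro: sigma_form_pi_form.intros)

lemma sigma_of_defset:
  assumes "sigma_form k \<phi>" "A = defset M (\<lambda>_. {}) \<pi> \<phi>"
  shows "sigma M Z k (\<lambda>\<rho>. \<rho> 0 \<in> A)"
proof -
  have "inst (case_nat (Inr 0) (Inl \<circ> \<pi>)) \<rho> = case_nat (\<rho> 0) \<pi>" for \<rho>
    by (auto simp: inst_def fun_eq_iff split: nat.split)
  then show ?thesis unfolding sigma_def
    using assms sigma_pi_form_drop_members[of k \<phi>]
    by (intro exI[of _ "drop_members \<phi>"] exI[of _ "case_nat (Inr 0) (Inl \<circ> \<pi>)"])
       (auto simp: defset_def sat_drop_members)
qed

lemma sigma_not_of_defset:
  assumes "pi_form k \<phi>" "A = defset M (\<lambda>_. {}) \<pi> \<phi>"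
  shows "sigma M Z k (\<lambda>\<rho>. \<rho> 0 \<notin> A)"
proof -
  obtain \<chi> where \<chi>: "sigma_form k \<chi>" "\<And>\<sigma> \<rho>. sat M \<sigma> \<rho> \<chi> = (\<not> sat M \<sigma> \<rho> \<phi>)"
    using sigma_pi_form_neg assms(1) by metis
  with assms(2) have "- A = defset M (\<lambda>_. {}) \<pi> \<chi>" by (auto simp: defset_def)
  from sigma_of_defset[OF \<chi>(1) this] show ?thesis by simp
qed

section \<open>Arithmetic in a model\<close>

text \<open>\<open>Z\<close> is an oracle: the empty set when the family is defined, the graph of
  \<open>h\<close> when the rainbow is computed.\<close>

locale arith_model =
  fixes M :: "'a l2_struct" and Z :: "'a set"
  assumes basic: "basic_axioms M"
    and induction_1: "Sigma_induction 1 M"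
    and induction_2: "Sigma_induction 2 M"
    and Z_in_sets: "Z \<in> sets M"
begin

abbreviation z0 ("\<zero>") where "\<zero> \<equiv> zero M"
abbreviation z1 ("\<one>") where "\<one> \<equiv> one M"
abbreviation plus (infixl "\<oplus>" 65) where "x \<oplus> y \<equiv> add M x y"
abbreviation times (infixl "\<otimes>" 70) where "x \<otimes> y \<equiv> mul M x y"
abbreviation less (infix "\<prec>" 50) where "x \<prec> y \<equiv> lt M x y"

definition le (infix "\<preceq>" 50) where "x \<preceq> y \<longleftrightarrow> x \<prec> y \<or> x = y"

lemma ax [simp]:
  "n \<oplus> \<one> \<noteq> \<zero>" "m \<oplus> \<one> = n \<oplus> \<one> \<longleftrightarrow> m = n" "m \<oplus> \<zero> = m" 
  "m \<otimes> \<zero> = \<zero>" "\<not> m \<prec> \<zero>"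
  using basic unfolding basic_axioms_def by blast+

lemma ax_plus: "m \<oplus> (n \<oplus> \<one>) = (m \<oplus> n) \<oplus> \<one>"
  and ax_times: "m \<otimes> (n \<oplus> \<one>) = m \<otimes> n \<oplus> m"
  and less_Suc: "m \<prec> n \<oplus> \<one> \<longleftrightarrow> m \<prec> n \<or> m = n"
  using basic unfolding basic_axioms_def by blast+

lemma sigma_0_1: "sigma M Z 0 P \<Longrightarrow> sigma M Z 1 P"
  using sigma_Suc_ex[of M Z 0 "\<lambda>_. P"]
  by (simp add: sigma_0_not[OF sigma_ren[where r = Suc]])

lemma induct_1:
  assumes "sigma M Z 1 (\<lambda>\<rho>. P (\<rho> 0))" "P \<zero>" "\<And>n. P n \<Longrightarrow> P (n \<oplus> \<one>)" shows "P n"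
  using sigma_induct[OF induction_1 Z_in_sets assms] .

lemma induct_2:
  assumes "sigma M Z 2 (\<lambda>\<rho>. P (\<rho> 0))" "P \<zero>" "\<And>n. P n \<Longrightarrow> P (n \<oplus> \<one>)" shows "P n"
  using sigma_induct[OF induction_2 Z_in_sets assms] .

lemma induct_0:
  assumes "sigma M Z 0 (\<lambda>\<rho>. P (\<rho> 0))" "P \<zero>" "\<And>n. P n \<Longrightarrow> P (n \<oplus> \<one>)" shows "P n"
  by (rule induct_1) (use assms sigma_0_1 in auto)

lemma sigma_0_disj:
  assumes "sigma M Z 0 P" "sigma M Z 0 Q" shows "sigma M Z 0 (\<lambda>\<rho>. P \<rho> \<or> Q \<rho>)"
  using sigma_0_not[OF sigma_0_conj[OF assms[THEN sigma_0_not]]] by simp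

lemma sigma_0_imp:
  assumes "sigma M Z 0 P" "sigma M Z 0 Q" shows "sigma M Z 0 (\<lambda>\<rho>. P \<rho> \<longrightarrow> Q \<rho>)"
  unfolding imp_conv_disj by (rule sigma_0_disj[OF sigma_0_not[OF assms(1)] assms(2)])

lemmas trm_intros = trm_var trm_const trm_add trm_mul trm_pair
lemmas sigma_0_intros = sigma_0_eq sigma_0_lt sigma_0_mem sigma_0_not sigma_0_conj sigma_0_disj sigma_0_imp

section \<open>Semiring laws\<close>

lemma zero_plus [simp]: "\<zero> \<oplus> x = x"
  by (rule induct_0[where n = x]) (intro sigma_0_intros trm_intros | simp add: ax_plus)+

lemma Suc_plus: "(x \<oplus> \<one>) \<oplus> y = (x \<oplus> y) \<oplus> \<one>"
  by (rule induct_0[where n = y]) (intro sigma_0_intros trm_intros | simp add: ax_plus)+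

lemma plus_commute: "x \<oplus> y = y \<oplus> x"
  by (rule induct_0[where n = y]) (intro sigma_0_intros trm_intros | simp add: ax_plus Suc_plus)+

lemma plus_assoc: "x \<oplus> y \<oplus> z = x \<oplus> (y \<oplus> z)"
  by (rule induct_0[where n = z]) (intro sigma_0_intros trm_intros | simp add: ax_plus)+

lemma plus_left_commute: "x \<oplus> (y \<oplus> z) = y \<oplus> (x \<oplus> z)"
  by (metis plus_assoc plus_commute)

lemmas plus_ac = plus_assoc plus_commute plus_left_commute

lemma zero_times [simp]: "\<zero> \<otimes> x = \<zero>"
  by (rule induct_0[where n = x]) (intro sigma_0_intros trm_intros | simp add: ax_times)+

lemma Suc_times: "(x \<oplus> \<one>) \<otimes> y = x \<otimes> y \<oplus> y"
proof (rule induct_0[where n = y])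
  show "(x \<oplus> \<one>) \<otimes> (n \<oplus> \<one>) = x \<otimes> (n \<oplus> \<one>) \<oplus> (n \<oplus> \<one>)"
    if "(x \<oplus> \<one>) \<otimes> n = x \<otimes> n \<oplus> n" for n
    by (simp add: ax_times that plus_ac)
qed (intro sigma_0_intros trm_intros | simp)+

lemma times_commute: "x \<otimes> y = y \<otimes> x"
  by (rule induct_0[where n = y]) (intro sigma_0_intros trm_intros | simp add: ax_times Suc_times)+

lemma distrib_left: "x \<otimes> (y \<oplus> z) = x \<otimes> y \<oplus> x \<otimes> z"
  by (rule induct_0[where n = z])
     (intro sigma_0_intros trm_intros | simp add: ax_times ax_plus plus_assoc del: plus_assoc | simp add: plus_assoc)+

lemma distrib_right: "(y \<oplus> z) \<otimes> x = y \<otimes> x \<oplus> z \<otimes> x"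
  by (metis distrib_left times_commute)

lemma times_assoc: "x \<otimes> y \<otimes> z = x \<otimes> (y \<otimes> z)"
  by (rule induct_0[where n = z]) (intro sigma_0_intros trm_intros | simp add: ax_times | simp add: distrib_left)+

lemma times_left_commute: "x \<otimes> (y \<otimes> z) = y \<otimes> (x \<otimes> z)"
  by (metis times_assoc times_commute)

lemma times_one [simp]: "x \<otimes> \<one> = x" "\<one> \<otimes> x = x"
  using ax_times[of x "\<zero>"] by (simp_all add: times_commute)

lemmas semiring_simps = plus_ac times_assoc times_commute times_left_commute distrib_left distrib_right

section \<open>The linear order\<close>

lemma less_trans: "a \<prec> b \<Longrightarrow> b \<prec> c \<Longrightarrow> a \<prec> c"
proof -
  have "a \<prec> b \<and> b \<prec> c \<longrightarrow> a \<prec> c"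
    by (rule induct_0[where n = c]) (intro sigma_0_intros trm_intros | auto simp: less_Suc)+
  then show "a \<prec> b \<Longrightarrow> b \<prec> c \<Longrightarrow> a \<prec> c" by blast
qed

lemma less_irrefl [simp]: "\<not> a \<prec> a"
proof (rule induct_0[where n = a])
  show "\<not> n \<oplus> \<one> \<prec> n \<oplus> \<one>" if "\<not> n \<prec> n" for n
    using that by (metis less_Suc less_trans)
qed (intro sigma_0_intros trm_intros | simp)+

lemma zero_le [simp]: "\<zero> \<preceq> x"
  unfolding le_def by (rule induct_0[where n = x]) (intro sigma_0_intros trm_intros | auto simp: less_Suc)+

lemma Suc_less_Suc: "a \<prec> b \<Longrightarrow> a \<oplus> \<one> \<prec> b \<oplus> \<one>"
proof -
  have "a \<prec> b \<longrightarrow> a \<oplus> \<one> \<prec> b \<oplus> \<one>"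
    by (rule induct_0[where n = b]) (intro sigma_0_intros trm_intros | auto simp: less_Suc)+
  then show "a \<prec> b \<Longrightarrow> a \<oplus> \<one> \<prec> b \<oplus> \<one>" by blast
qed

lemma less_linear: "a \<prec> b \<or> a = b \<or> b \<prec> a"
proof (rule induct_0[where n = a])
  show "\<zero> \<prec> b \<or> \<zero> = b \<or> b \<prec> \<zero>" using zero_le[of b] by (auto simp: le_def)
  show "n \<oplus> \<one> \<prec> b \<or> n \<oplus> \<one> = b \<or> b \<prec> n \<oplus> \<one>" if "n \<prec> b \<or> n = b \<or> b \<prec> n" for n
    using that Suc_less_Suc[of n b] by (auto simp: less_Suc)
qed (intro sigma_0_intros trm_intros)

sublocale linorder le less
proof
  show "x \<prec> y \<longleftrightarrow> x \<preceq> y \<and> \<not> y \<preceq> x" for x y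
    using less_trans[of x y x] less_irrefl[of x] by (auto simp: le_def)
  show "x \<preceq> z" if "x \<preceq> y" "y \<preceq> z" for x y z
    using that less_trans[of x y z] by (auto simp: le_def)
  show "x = y" if "x \<preceq> y" "y \<preceq> x" for x y
    using that less_trans[of x y x] by (auto simp: le_def)
  show "x \<preceq> y \<or> y \<preceq> x" for x y using less_linear[of x y] by (auto simp: le_def)
qed (simp add: le_def)

lemma less_Suc_le: "a \<prec> b \<oplus> \<one> \<longleftrightarrow> a \<preceq> b" by (simp add: less_Suc le_def)

lemma Suc_le: "a \<oplus> \<one> \<preceq> b \<longleftrightarrow> a \<prec> b"
  by (metis Suc_less_Suc less_Suc_le less_Suc not_less le_def)

lemma less_plus_Suc: "a \<prec> a \<oplus> d \<oplus> \<one>"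
  by (rule induct_0[where n = d]) (intro sigma_0_intros trm_intros | auto simp: less_Suc plus_assoc[symmetric])+

lemma le_plus [simp]: "a \<preceq> a \<oplus> d" "a \<preceq> d \<oplus> a"
  using less_plus_Suc[of a d] by (simp_all add: less_Suc_le plus_commute[of d])

lemma less_iff: "a \<prec> b \<longleftrightarrow> (\<exists>d. b = a \<oplus> d \<oplus> \<one>)"
proof
  have "a \<prec> b \<longrightarrow> (\<exists>d. b = a \<oplus> d \<oplus> \<one>)"
  proof -
    have "\<exists>d. a \<prec> b \<longrightarrow> b = a \<oplus> d \<oplus> \<one>"
    proof (rule induct_1[where n = b])
      show "sigma M Z 1 (\<lambda>\<rho>. \<exists>d. a \<prec> \<rho> 0 \<longrightarrow> \<rho> 0 = a \<oplus> d \<oplus> \<one>)"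
        unfolding One_nat_def by (intro sigma_Suc_ex sigma_0_intros trm_intros)
      show "\<exists>d. a \<prec> n \<oplus> \<one> \<longrightarrow> n \<oplus> \<one> = a \<oplus> d \<oplus> \<one>" if "\<exists>d. a \<prec> n \<longrightarrow> n = a \<oplus> d \<oplus> \<one>" for n
        using that by (metis ax(3) less_Suc ax_plus)
    qed simp
    then show ?thesis by blast
  qed
  then show "a \<prec> b \<Longrightarrow> \<exists>d. b = a \<oplus> d \<oplus> \<one>" by blast
qed (use less_plus_Suc in blast)

lemma le_iff: "a \<preceq> b \<longleftrightarrow> (\<exists>d. b = a \<oplus> d)"
  by (metis less_Suc_le less_iff ax(2) le_plus(1))

lemma plus_less_mono1: "a \<prec> b \<Longrightarrow> a \<oplus> c \<prec> b \<oplus> c"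
  unfolding less_iff by (metis plus_assoc plus_commute)

lemma plus_less_cancel [simp]: "a \<oplus> c \<prec> b \<oplus> c \<longleftrightarrow> a \<prec> b" "c \<oplus> a \<prec> c \<oplus> b \<longleftrightarrow> a \<prec> b"
  using plus_less_mono1 less_linear less_asym plus_commute less_irrefl by metis+

lemma plus_le_cancel [simp]: "a \<oplus> c \<preceq> b \<oplus> c \<longleftrightarrow> a \<preceq> b" "c \<oplus> a \<preceq> c \<oplus> b \<longleftrightarrow> a \<preceq> b"
  by (simp_all flip: not_less)

lemma plus_cancel [simp]: "a \<oplus> c = b \<oplus> c \<longleftrightarrow> a = b" "c \<oplus> a = c \<oplus> b \<longleftrightarrow> a = b"
  by (simp_all add: order.eq_iff)

lemma times_le_mono1: "a \<preceq> b \<Longrightarrow> a \<otimes> c \<preceq> b \<otimes> c"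
  unfolding le_iff by (metis distrib_right)

lemma times_less_mono1: "a \<prec> b \<Longrightarrow> \<zero> \<prec> c \<Longrightarrow> a \<otimes> c \<prec> b \<otimes> c"
proof -
  assume "a \<prec> b" "\<zero> \<prec> c"
  then obtain d where d: "b = a \<oplus> d \<oplus> \<one>" by (auto simp: less_iff)
  have "a \<otimes> c \<prec> a \<otimes> c \<oplus> c" using \<open>\<zero> \<prec> c\<close> plus_less_cancel(2)[of "a \<otimes> c" "\<zero>" c] by simp
  also have "\<dots> \<preceq> b \<otimes> c" unfolding d by (simp add: distrib_right)
  finally show ?thesis .
qed

lemma times_le_mono: "a \<preceq> b \<Longrightarrow> c \<preceq> d \<Longrightarrow> a \<otimes> c \<preceq> b \<otimes> d"
  by (metis order_trans times_le_mono1 times_commute)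

lemma plus_le_mono: "a \<preceq> b \<Longrightarrow> c \<preceq> d \<Longrightarrow> a \<oplus> c \<preceq> b \<oplus> d"
  by (metis order_trans plus_le_cancel)

text \<open>With \<open>s = m \<oplus> n\<close> the code lies between the square of
  \<open>s\<close> and that square plus \<open>s\<close>, hence below the square of
  \<open>s \<oplus> \<one>\<close>. So the code determines \<open>s\<close>, and then
  \<open>m\<close> by cancellation.\<close>

lemma pair_inj [simp]: "pair M m n = pair M m' n' \<longleftrightarrow> m = m' \<and> n = n'"
proof
  have *: "pair M m n \<prec> pair M m' n'" if "m \<oplus> n \<prec> m' \<oplus> n'" for m n m' n'
  proof -
    let ?s = "m \<oplus> n"
    have "pair M m n \<preceq> ?s \<otimes> ?s \<oplus> ?s" by (simp add: pair_def)
    also have "\<dots> \<prec> ?s \<otimes> ?s \<oplus> ?s \<oplus> ?s \<oplus> \<one>"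
      by (rule less_plus_Suc)
    also have "\<dots> = (?s \<oplus> \<one>) \<otimes> (?s \<oplus> \<one>)" by (simp add: ax_times Suc_times ax_plus)
    also have "\<dots> \<preceq> (m' \<oplus> n') \<otimes> (m' \<oplus> n')" using that by (intro times_le_mono) (simp_all add: Suc_le)
    also have "\<dots> \<preceq> pair M m' n'" by (simp add: pair_def)
    finally show ?thesis .
  qed
  assume eq: "pair M m n = pair M m' n'"
  then have s: "m \<oplus> n = m' \<oplus> n'" using * less_linear less_irrefl by metis
  with eq have "m = m'" by (simp add: pair_def)
  with s show "m = m' \<and> n = n'" by simp
qed simp

lemma le_times_self: "x \<preceq> x \<otimes> x"
proof (cases "x = \<zero>")
  case False
  then have "\<one> \<preceq> x" using zero_le[of x] Suc_le[of "\<zero>" x] by (auto simp: le_def)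
  from times_le_mono1[OF this, of x] show ?thesis by simp
qed simp

lemma le_pair: "m \<preceq> pair M m n" "n \<preceq> pair M m n"
proof -
  show "m \<preceq> pair M m n" by (simp add: pair_def)
  have "n \<preceq> m \<oplus> n" by simp
  also have "\<dots> \<preceq> (m \<oplus> n) \<otimes> (m \<oplus> n)" by (rule le_times_self)
  also have "\<dots> \<preceq> pair M m n" by (simp add: pair_def)
  finally show "n \<preceq> pair M m n" .
qed

lemma pair_mono: "m \<preceq> m' \<Longrightarrow> n \<preceq> n' \<Longrightarrow> pair M m n \<preceq> pair M m' n'"
  unfolding pair_def by (intro plus_le_mono times_le_mono)

end

section \<open>Closure properties of the arithmetical classes\<close>

lemma sigma_Suc_of_not: "sigma M Z k (\<lambda>\<rho>. \<not> P \<rho>) \<Longrightarrow> sigma M Z (Suc k) P"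
  using sigma_Suc_ex[of M Z k "\<lambda>_. P"] sigma_ren[of M Z k "\<lambda>\<rho>. \<not> P \<rho>" Suc] by simp

lemma sigma_Suc_mono: "sigma M Z k P \<Longrightarrow> sigma M Z (Suc k) P"
proof (induction k arbitrary: P)
  case 0
  then show ?case by (intro sigma_Suc_of_not sigma_0_not)
next
  case (Suc k)
  obtain Q where "sigma M Z k (\<lambda>\<rho>. \<not> Q (\<rho> 0) (\<lambda>i. \<rho> (Suc i)))" "P = (\<lambda>\<rho>. \<exists>x. Q x \<rho>)"
    using sigma_SucE[OF Suc.prems] .
  with Suc.IH show ?case by (auto intro: sigma_Suc_ex)
qed

lemma sigma_mono: assumes "sigma M Z j P" "j \<le> k" shows "sigma M Z k P"
  using assms(2,1) by (induction rule: dec_induct) (auto intro: sigma_Suc_mono)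

text \<open>The closure properties are bundled because they climb from one level to the next
  together. The bounded universal quantifier is the clause that costs collection, hence
  induction.\<close>

locale sigma_closed =
  fixes M :: "'a l2_struct" and Z :: "'a set" and k :: nat
  assumes conj: "sigma M Z k P \<Longrightarrow> sigma M Z k Q \<Longrightarrow> sigma M Z k (\<lambda>\<rho>. P \<rho> \<and> Q \<rho>)"
    and disj: "sigma M Z k P \<Longrightarrow> sigma M Z k Q \<Longrightarrow> sigma M Z k (\<lambda>\<rho>. P \<rho> \<or> Q \<rho>)"
    and ball: "trm M t \<Longrightarrow> sigma M Z k (\<lambda>\<rho>. R (\<rho> 0) (\<lambda>i. \<rho> (Suc i))) \<Longrightarrow>
      sigma M Z k (\<lambda>\<rho>. \<forall>x. lt M x (t \<rho>) \<longrightarrow> R x \<rho>)"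
    and bex: "trm M t \<Longrightarrow> sigma M Z k (\<lambda>\<rho>. R (\<rho> 0) (\<lambda>i. \<rho> (Suc i))) \<Longrightarrow>
      sigma M Z k (\<lambda>\<rho>. \<exists>x. lt M x (t \<rho>) \<and> R x \<rho>)"

context arith_model
begin

lemma sigma_closed_0: "sigma_closed M Z 0"
proof -
  have "sigma M Z 0 (\<lambda>\<rho>. \<exists>x. x \<prec> t \<rho> \<and> P x \<rho>)"
    if "trm M t" "sigma M Z 0 (\<lambda>\<rho>. P (\<rho> 0) (\<lambda>i. \<rho> (Suc i)))" for t P
    using sigma_0_not[OF sigma_0_ball[OF that(1) sigma_0_not[OF that(2)]]] by simp
  then show ?thesis by (intro sigma_closed.intro sigma_0_conj sigma_0_disj sigma_0_ball)
qed

text \<open>Induction on an initial segment \<open>n\<close>: since \<open>Q\<close> is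
  \<open>\<Pi>\<close> of level \<open>k\<close>, closure of level \<open>k\<close> under bounded
  quantifiers makes the existence of a bound for the witnesses up to \<open>n\<close> a
  \<open>\<Sigma>\<close> statement of level \<open>Suc k\<close>. The guard
  \<open>x \<prec> a\<close> lets it persist beyond \<open>a\<close>.\<close>

lemma collection_step:
  assumes closed: "sigma_closed M Z k" and ind: "Sigma_induction (Suc k) M"
    and Q: "sigma M Z k (\<lambda>\<rho>. \<not> Q (\<rho> 0) (\<rho> (Suc 0)))"
    and total: "\<forall>x. x \<prec> a \<longrightarrow> (\<exists>y. Q y x)"
  shows "\<exists>w. \<forall>x. x \<prec> a \<longrightarrow> (\<exists>y. y \<prec> w \<and> Q y x)"
proof -
  let ?R = "\<lambda>n. \<exists>w. \<forall>x. x \<prec> n \<longrightarrow> x \<prec> a \<longrightarrow> (\<exists>y. y \<prec> w \<and> Q y x)"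
  have "?R a"
  proof (rule sigma_induct[OF ind Z_in_sets, where P = ?R])
    have "sigma M Z k (\<lambda>\<rho>. \<exists>x. x \<prec> \<rho> (Suc 0) \<and> x \<prec> a \<and> (\<forall>y. y \<prec> \<rho> 0 \<longrightarrow> \<not> Q y x))"
      by (intro sigma_closed.bex[OF closed] sigma_closed.ball[OF closed] sigma_closed.conj[OF closed]
          sigma_mono[OF sigma_0_lt] trm_var trm_const Q le0)
    then show "sigma M Z (Suc k) (\<lambda>\<rho>. ?R (\<rho> 0))"
      by (intro sigma_Suc_ex) simp
    show "?R \<zero>" by simp
    show "?R (n \<oplus> \<one>)" if "?R n" for n
    proof (cases "n \<prec> a")
      case True
      with total obtain y where y: "Q y n" by blast
      from that obtain w where w: "\<forall>x. x \<prec> n \<longrightarrow> x \<prec> a \<longrightarrow> (\<exists>y. y \<prec> w \<and> Q y x)" by blast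
      have "\<exists>y'. y' \<prec> w \<oplus> y \<oplus> \<one> \<and> Q y' x" if x: "x \<prec> n \<oplus> \<one>" "x \<prec> a" for x
      proof (cases "x = n")
        case True
        then show ?thesis using y by (intro exI[of _ y]) (simp add: less_Suc_le)
      next
        case False
        with x w obtain y' where "y' \<prec> w" "Q y' x" by (auto simp: less_Suc)
        then show ?thesis by (meson le_plus(1) less_Suc_le less_imp_le order.trans)
      qed
      then show ?thesis by blast
    next
      case False
      with that show ?thesis by (auto simp: less_Suc)
    qed
  qed
  then show ?thesis by blast
qed

lemma sigma_closed_Suc:
  assumes closed: "sigma_closed M Z k" and ind: "Sigma_induction (Suc k) M"
  shows "sigma_closed M Z (Suc k)"
    and "sigma M Z (Suc k) (\<lambda>\<rho>. P (\<rho> 0) (\<lambda>i. \<rho> (Suc i))) \<Longrightarrow> sigma M Z (Suc k) (\<lambda>\<rho>. \<exists>x. P x \<rho>)"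
proof -
  interpret k: sigma_closed M Z k by (rule closed)
  \<comment> \<open>Two leading existential quantifiers merge into one that bounds both witnesses;
    the bounded quantifiers left over are absorbed by level \<open>k\<close>.\<close>
  have join: "(\<exists>x. A x) \<and> (\<exists>y. B y) \<longleftrightarrow> (\<exists>w. (\<exists>x. x \<prec> w \<and> A x) \<and> (\<exists>y. y \<prec> w \<and> B y))" for A B
    by (metis le_plus less_Suc_le)
  have conj': "sigma M Z (Suc k) (\<lambda>\<rho>. P \<rho> \<and> Q \<rho>)" and disj': "sigma M Z (Suc k) (\<lambda>\<rho>. P \<rho> \<or> Q \<rho>)"
    if PQ: "sigma M Z (Suc k) P" "sigma M Z (Suc k) Q" for P Q
  proof -
    obtain P1 where P1: "sigma M Z k (\<lambda>\<rho>. \<not> P1 (\<rho> 0) (\<lambda>i. \<rho> (Suc i)))" "P = (\<lambda>\<rho>. \<exists>x. P1 x \<rho>)"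
      using sigma_SucE[OF PQ(1)] .
    obtain Q1 where Q1: "sigma M Z k (\<lambda>\<rho>. \<not> Q1 (\<rho> 0) (\<lambda>i. \<rho> (Suc i)))" "Q = (\<lambda>\<rho>. \<exists>x. Q1 x \<rho>)"
      using sigma_SucE[OF PQ(2)] .
    have "sigma M Z k (\<lambda>\<rho>. \<not> P1 (\<rho> 0) (\<lambda>i. \<rho> (Suc (Suc i))))"
      "sigma M Z k (\<lambda>\<rho>. \<not> Q1 (\<rho> 0) (\<lambda>i. \<rho> (Suc (Suc i))))"
      using sigma_ren[OF P1(1), of "case_nat 0 (Suc \<circ> Suc)"] sigma_ren[OF Q1(1), of "case_nat 0 (Suc \<circ> Suc)"]
      by simp_all
    then have "sigma M Z k (\<lambda>\<rho>. (\<forall>x. x \<prec> \<rho> 0 \<longrightarrow> \<not> P1 x (\<lambda>i. \<rho> (Suc i))) \<or>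
        (\<forall>y. y \<prec> \<rho> 0 \<longrightarrow> \<not> Q1 y (\<lambda>i. \<rho> (Suc i))))"
      by (intro k.disj k.ball trm_var)
    then have "sigma M Z (Suc k) (\<lambda>\<rho>. \<exists>w. (\<exists>x. x \<prec> w \<and> P1 x \<rho>) \<and> (\<exists>y. y \<prec> w \<and> Q1 y \<rho>))"
      by (intro sigma_Suc_ex) simp
    moreover have "P \<rho> \<and> Q \<rho> \<longleftrightarrow> (\<exists>w. (\<exists>x. x \<prec> w \<and> P1 x \<rho>) \<and> (\<exists>y. y \<prec> w \<and> Q1 y \<rho>))" for \<rho>
      unfolding P1(2) Q1(2) by (rule join)
    ultimately show "sigma M Z (Suc k) (\<lambda>\<rho>. P \<rho> \<and> Q \<rho>)" by simp
    have "sigma M Z (Suc k) (\<lambda>\<rho>. \<exists>x. P1 x \<rho> \<or> Q1 x \<rho>)"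
      using k.conj[OF P1(1) Q1(1)] by (intro sigma_Suc_ex) simp
    then show "sigma M Z (Suc k) (\<lambda>\<rho>. P \<rho> \<or> Q \<rho>)" by (simp add: P1(2) Q1(2) ex_disj_distrib)
  qed
  have ex': "sigma M Z (Suc k) (\<lambda>\<rho>. \<exists>x. P x \<rho>)"
    if P: "sigma M Z (Suc k) (\<lambda>\<rho>. P (\<rho> 0) (\<lambda>i. \<rho> (Suc i)))" for P
  proof -
    obtain Q where Q: "sigma M Z k (\<lambda>\<rho>. \<not> Q (\<rho> 0) (\<lambda>i. \<rho> (Suc i)))"
      "(\<lambda>\<rho>. P (\<rho> 0) (\<lambda>i. \<rho> (Suc i))) = (\<lambda>\<rho>. \<exists>y. Q y \<rho>)"
      using sigma_SucE[OF P] .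
    have PQ: "P x \<rho> = (\<exists>y. Q y (case_nat x \<rho>))" for x \<rho>
      using fun_cong[OF Q(2), of "case_nat x \<rho>"] by simp
    \<comment> \<open>Under the two bounded quantifiers the environment starts with
      \<open>y\<close>, \<open>x\<close>, \<open>w\<close>. The renaming skips position 2, since
      \<open>Q\<close> knows nothing of the bound \<open>w\<close>.\<close>
    have env: "(\<lambda>i. \<rho> (case_nat 0 (case_nat (Suc 0) (Suc \<circ> Suc \<circ> Suc)) (Suc i))) =
        case_nat (\<rho> (Suc 0)) (\<lambda>i. \<rho> (Suc (Suc (Suc i))))" for \<rho> :: "nat \<Rightarrow> 'a"
      by (auto simp: fun_eq_iff split: nat.split)
    have "sigma M Z k (\<lambda>\<rho>. \<not> Q (\<rho> 0) (case_nat (\<rho> (Suc 0)) (\<lambda>i. \<rho> (Suc (Suc (Suc i))))))"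
      using sigma_ren[OF Q(1), of "case_nat 0 (case_nat (Suc 0) (Suc \<circ> Suc \<circ> Suc))"] unfolding env by simp
    then have "sigma M Z k (\<lambda>\<rho>. \<forall>x. x \<prec> \<rho> 0 \<longrightarrow> (\<forall>y. y \<prec> \<rho> 0 \<longrightarrow> \<not> Q y (case_nat x (\<lambda>i. \<rho> (Suc i)))))"
      by (intro k.ball trm_var)
    then have "sigma M Z (Suc k) (\<lambda>\<rho>. \<exists>w. \<exists>x. x \<prec> w \<and> (\<exists>y. y \<prec> w \<and> Q y (case_nat x \<rho>)))"
      by (intro sigma_Suc_ex) simp
    moreover have "(\<exists>x. P x \<rho>) = (\<exists>w. \<exists>x. x \<prec> w \<and> (\<exists>y. y \<prec> w \<and> Q y (case_nat x \<rho>)))" for \<rho>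
      unfolding PQ by (metis le_plus less_Suc_le)
    ultimately show ?thesis by simp
  qed
  have lt_Suc: "sigma M Z (Suc k) (\<lambda>\<rho>. t1 \<rho> \<prec> t2 \<rho>)" if "trm M t1" "trm M t2" for t1 t2
    by (rule sigma_mono[OF sigma_0_lt[OF that]]) simp
  have bex': "sigma M Z (Suc k) (\<lambda>\<rho>. \<exists>x. x \<prec> t \<rho> \<and> P x \<rho>)"
    if "trm M t" "sigma M Z (Suc k) (\<lambda>\<rho>. P (\<rho> 0) (\<lambda>i. \<rho> (Suc i)))" for t P
    using that by (intro ex' conj' lt_Suc trm_var trm_ren[OF that(1)])
  have ball': "sigma M Z (Suc k) (\<lambda>\<rho>. \<forall>x. x \<prec> t \<rho> \<longrightarrow> P x \<rho>)"
    if t: "trm M t" and P: "sigma M Z (Suc k) (\<lambda>\<rho>. P (\<rho> 0) (\<lambda>i. \<rho> (Suc i)))" for t P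
  proof -
    obtain Q where Q: "sigma M Z k (\<lambda>\<rho>. \<not> Q (\<rho> 0) (\<lambda>i. \<rho> (Suc i)))"
      "(\<lambda>\<rho>. P (\<rho> 0) (\<lambda>i. \<rho> (Suc i))) = (\<lambda>\<rho>. \<exists>y. Q y \<rho>)"
      using sigma_SucE[OF P] .
    have PQ: "P x \<rho> = (\<exists>y. Q y (case_nat x \<rho>))" for x \<rho>
      using fun_cong[OF Q(2), of "case_nat x \<rho>"] by simp
    have env: "(\<lambda>i. \<rho> (case_nat 0 (case_nat (Suc 0) (Suc \<circ> Suc \<circ> Suc)) (Suc i))) =
        case_nat (\<rho> (Suc 0)) (\<lambda>i. \<rho> (Suc (Suc (Suc i))))" for \<rho> :: "nat \<Rightarrow> 'a"
      by (auto simp: fun_eq_iff split: nat.split)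
    have "sigma M Z k (\<lambda>\<rho>. \<not> Q (\<rho> 0) (case_nat (\<rho> (Suc 0)) (\<lambda>i. \<rho> (Suc (Suc (Suc i))))))"
      using sigma_ren[OF Q(1), of "case_nat 0 (case_nat (Suc 0) (Suc \<circ> Suc \<circ> Suc))"] unfolding env by simp
    then have "sigma M Z k (\<lambda>\<rho>. \<exists>x. x \<prec> t (\<lambda>i. \<rho> (Suc i)) \<and>
        (\<forall>y. y \<prec> \<rho> 0 \<longrightarrow> \<not> Q y (case_nat x (\<lambda>i. \<rho> (Suc i)))))"
      by (intro k.ball k.bex trm_var trm_ren[OF t])
    then have "sigma M Z (Suc k) (\<lambda>\<rho>. \<exists>w. \<forall>x. x \<prec> t \<rho> \<longrightarrow> (\<exists>y. y \<prec> w \<and> Q y (case_nat x \<rho>)))"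
      by (intro sigma_Suc_ex) simp
    moreover have "(\<forall>x. x \<prec> t \<rho> \<longrightarrow> P x \<rho>) \<longleftrightarrow>
        (\<exists>w. \<forall>x. x \<prec> t \<rho> \<longrightarrow> (\<exists>y. y \<prec> w \<and> Q y (case_nat x \<rho>)))" for \<rho>
    proof
      assume "\<forall>x. x \<prec> t \<rho> \<longrightarrow> P x \<rho>"
      then have total: "\<forall>x. x \<prec> t \<rho> \<longrightarrow> (\<exists>y. Q y (case_nat x \<rho>))" by (simp add: PQ)
      obtain \<phi> s where \<phi>: "sigma_form k \<phi>"
        "\<And>\<eta>. (\<not> Q (\<eta> 0) (\<lambda>i. \<eta> (Suc i))) = sat M (\<lambda>_. Z) (inst s \<eta>) \<phi>"
        using Q(1) unfolding sigma_def by auto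
      \<comment> \<open>\<open>collection_step\<close> treats relations between two numbers, so
        positions 0 and 1 stay variable and the rest of the environment \<open>\<rho>\<close> is
        frozen into parameters.\<close>
      define s' where "s' i = (case s i of Inl c \<Rightarrow> Inl c | Inr j \<Rightarrow>
        (if j \<le> 1 then Inr j else Inl (\<rho> (j - 2))))" for i
      have "inst s' \<eta> = inst s (case_nat (\<eta> 0) (case_nat (\<eta> (Suc 0)) \<rho>))" for \<eta>
        by (auto simp: inst_def s'_def fun_eq_iff numeral_2_eq_2 le_Suc_eq not_le split: sum.split nat.split)
      then have "sigma M Z k (\<lambda>\<eta>. \<not> Q (\<eta> 0) (case_nat (\<eta> (Suc 0)) \<rho>))"
        unfolding sigma_def using \<phi>(1) by (intro exI[of _ \<phi>] exI[of _ s']) (simp flip: \<phi>(2))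
      from collection_step[OF closed ind this total]
      show "\<exists>w. \<forall>x. x \<prec> t \<rho> \<longrightarrow> (\<exists>y. y \<prec> w \<and> Q y (case_nat x \<rho>))" .
    next
      assume "\<exists>w. \<forall>x. x \<prec> t \<rho> \<longrightarrow> (\<exists>y. y \<prec> w \<and> Q y (case_nat x \<rho>))"
      then show "\<forall>x. x \<prec> t \<rho> \<longrightarrow> P x \<rho>" by (auto simp: PQ)
    qed
    ultimately show ?thesis by simp
  qed
  show "sigma_closed M Z (Suc k)"
    by (intro sigma_closed.intro conj' disj' ball' bex')
  show "sigma M Z (Suc k) (\<lambda>\<rho>. P (\<rho> 0) (\<lambda>i. \<rho> (Suc i))) \<Longrightarrow> sigma M Z (Suc k) (\<lambda>\<rho>. \<exists>x. P x \<rho>)"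
    by (rule ex')
qed

lemma sigma_induction_le_2: "k < 2 \<Longrightarrow> Sigma_induction (Suc k) M"
  using induction_1 induction_2 by (cases k) (auto simp: numeral_2_eq_2)

lemma sigma_closed: "k \<le> 2 \<Longrightarrow> sigma_closed M Z k"
  by (induction k) (simp_all add: sigma_closed_0 sigma_closed_Suc sigma_induction_le_2)

lemma induct_le_2:
  assumes "k \<le> 2" "sigma M Z k (\<lambda>\<rho>. P (\<rho> 0))" "P \<zero>" "\<And>n. P n \<Longrightarrow> P (n \<oplus> \<one>)" shows "P n"
  using induct_0[of P n] sigma_induct[OF sigma_induction_le_2 Z_in_sets, of "k - 1" P n] assms
  by (cases k) auto

lemma sigma_conj: "k \<le> 2 \<Longrightarrow> sigma M Z k P \<Longrightarrow> sigma M Z k Q \<Longrightarrow> sigma M Z k (\<lambda>\<rho>. P \<rho> \<and> Q \<rho>)"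
  by (rule sigma_closed.conj[OF sigma_closed])

lemma sigma_disj: "k \<le> 2 \<Longrightarrow> sigma M Z k P \<Longrightarrow> sigma M Z k Q \<Longrightarrow> sigma M Z k (\<lambda>\<rho>. P \<rho> \<or> Q \<rho>)"
  by (rule sigma_closed.disj[OF sigma_closed])

lemma sigma_ball:
  "k \<le> 2 \<Longrightarrow> trm M t \<Longrightarrow> sigma M Z k (\<lambda>\<rho>. P (\<rho> 0) (\<lambda>i. \<rho> (Suc i))) \<Longrightarrow>
    sigma M Z k (\<lambda>\<rho>. \<forall>x. x \<prec> t \<rho> \<longrightarrow> P x \<rho>)"
  by (rule sigma_closed.ball[OF sigma_closed])

lemma sigma_bex:
  "k \<le> 2 \<Longrightarrow> trm M t \<Longrightarrow> sigma M Z k (\<lambda>\<rho>. P (\<rho> 0) (\<lambda>i. \<rho> (Suc i))) \<Longrightarrow>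
    sigma M Z k (\<lambda>\<rho>. \<exists>x. x \<prec> t \<rho> \<and> P x \<rho>)"
  by (rule sigma_closed.bex[OF sigma_closed])

lemma sigma_ex:
  assumes "Suc k \<le> 2" "sigma M Z (Suc k) (\<lambda>\<rho>. P (\<rho> 0) (\<lambda>i. \<rho> (Suc i)))"
  shows "sigma M Z (Suc k) (\<lambda>\<rho>. \<exists>x. P x \<rho>)"
  using assms by (intro sigma_closed_Suc(2) sigma_closed sigma_induction_le_2) auto

text \<open>The leading quantifier of the \<open>\<Sigma>\<close> relation is bounded by the same
  \<open>w\<close> as \<open>y\<close>; what remains is simple enough for
  \<open>collection_step\<close>.\<close>

lemma collection:
  assumes "Suc k \<le> 2" "sigma M Z (Suc k) (\<lambda>\<rho>. Q (\<rho> 0) (\<rho> (Suc 0)))"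
    and "\<And>x. x \<prec> a \<Longrightarrow> \<exists>y. Q y x"
  obtains w where "\<And>x. x \<prec> a \<Longrightarrow> \<exists>y. y \<prec> w \<and> Q y x"
proof -
  obtain R where R: "sigma M Z k (\<lambda>\<rho>. \<not> R (\<rho> 0) (\<lambda>i. \<rho> (Suc i)))"
    "(\<lambda>\<rho>. Q (\<rho> 0) (\<rho> (Suc 0))) = (\<lambda>\<rho>. \<exists>z. R z \<rho>)"
    using sigma_SucE[OF assms(2)] .
  \<comment> \<open>Only positions 0 and 1 are read; \<open>x\<close> is a default value for all
    others.\<close>
  let ?env = "\<lambda>y x. case_nat y (case_nat x (\<lambda>_. x))"
  have Q: "Q y x = (\<exists>z. R z (?env y x))" for y x
    using fun_cong[OF R(2), of "?env y x"] by simp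
  let ?S = "\<lambda>w x. \<exists>y. y \<prec> w \<and> (\<exists>z. z \<prec> w \<and> R z (?env y x))"
  have env: "(\<lambda>i. \<rho> (case_nat 0 (case_nat (Suc 0) (\<lambda>_. Suc (Suc (Suc 0)))) (Suc i))) =
        ?env (\<rho> (Suc 0)) (\<rho> (Suc (Suc (Suc 0))))" for \<rho> :: "nat \<Rightarrow> 'a"
    by (auto simp: fun_eq_iff split: nat.split)
  have "sigma M Z k (\<lambda>\<rho>. \<not> R (\<rho> 0) (?env (\<rho> (Suc 0)) (\<rho> (Suc (Suc (Suc 0))))))"
    using sigma_ren[OF R(1), of "case_nat 0 (case_nat (Suc 0) (\<lambda>_. Suc (Suc (Suc 0))))"] unfolding env by simp
  then have "sigma M Z k (\<lambda>\<rho>. \<forall>y. y \<prec> \<rho> 0 \<longrightarrow> (\<forall>z. z \<prec> \<rho> 0 \<longrightarrow> \<not> R z (?env y (\<rho> (Suc 0)))))"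
    using assms(1) by (intro sigma_ball trm_var) auto
  then have "sigma M Z k (\<lambda>\<rho>. \<not> ?S (\<rho> 0) (\<rho> (Suc 0)))" by simp
  moreover have "\<exists>w. ?S w x" if "x \<prec> a" for x
    using assms(3)[OF that] unfolding Q by (metis le_plus less_Suc_le)
  ultimately obtain w where w: "\<forall>x. x \<prec> a \<longrightarrow> (\<exists>v. v \<prec> w \<and> ?S v x)"
    using collection_step[OF sigma_closed sigma_induction_le_2, of k ?S a] assms(1) by auto
  have "\<exists>y. y \<prec> w \<and> Q y x" if "x \<prec> a" for x
    using w[rule_format, OF that] unfolding Q by (meson less_trans)
  then show thesis by (rule that)
qed

section \<open>Predicates that are both \<open>\<Sigma>\<close> and \<open>\<Pi>\<close>\<close>

definition delta_pred :: "nat \<Rightarrow> ((nat \<Rightarrow> 'a) \<Rightarrow> bool) \<Rightarrow> bool" where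
  "delta_pred k P \<longleftrightarrow> sigma M Z k P \<and> sigma M Z k (\<lambda>\<rho>. \<not> P \<rho>)"

lemma delta_0: "sigma M Z 0 P \<Longrightarrow> delta_pred k P"
  unfolding delta_pred_def by (auto intro: sigma_mono[where j = 0] sigma_0_not)

lemma delta_mono: "delta_pred j P \<Longrightarrow> j \<le> k \<Longrightarrow> delta_pred k P"
  unfolding delta_pred_def by (auto intro: sigma_mono)

lemma delta_eq: "trm M t1 \<Longrightarrow> trm M t2 \<Longrightarrow> delta_pred k (\<lambda>\<rho>. t1 \<rho> = t2 \<rho>)"
  and delta_lt: "trm M t1 \<Longrightarrow> trm M t2 \<Longrightarrow> delta_pred k (\<lambda>\<rho>. t1 \<rho> \<prec> t2 \<rho>)"
  and delta_le: "trm M t1 \<Longrightarrow> trm M t2 \<Longrightarrow> delta_pred k (\<lambda>\<rho>. t1 \<rho> \<preceq> t2 \<rho>)"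
  and delta_mem: "trm M t1 \<Longrightarrow> delta_pred k (\<lambda>\<rho>. t1 \<rho> \<in> Z)"
  unfolding le_def by (intro delta_0 sigma_0_intros; assumption)+

lemma delta_const: "delta_pred k (\<lambda>\<rho>. b)"
  using delta_eq[of "\<lambda>_. \<zero>" "\<lambda>_. if b then \<zero> else \<one>" k] ax(1)[of \<zero>] by (cases b) (auto simp: trm_const)

lemma delta_not: "delta_pred k P \<Longrightarrow> delta_pred k (\<lambda>\<rho>. \<not> P \<rho>)"
  unfolding delta_pred_def by simp

lemma delta_conj: "k \<le> 2 \<Longrightarrow> delta_pred k P \<Longrightarrow> delta_pred k Q \<Longrightarrow> delta_pred k (\<lambda>\<rho>. P \<rho> \<and> Q \<rho>)"
  unfolding delta_pred_def de_Morgan_conj by (elim conjE, intro conjI sigma_conj sigma_disj; assumption)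

lemma delta_disj: "k \<le> 2 \<Longrightarrow> delta_pred k P \<Longrightarrow> delta_pred k Q \<Longrightarrow> delta_pred k (\<lambda>\<rho>. P \<rho> \<or> Q \<rho>)"
  unfolding delta_pred_def de_Morgan_disj by (elim conjE, intro conjI sigma_conj sigma_disj; assumption)

lemma delta_imp: "k \<le> 2 \<Longrightarrow> delta_pred k P \<Longrightarrow> delta_pred k Q \<Longrightarrow> delta_pred k (\<lambda>\<rho>. P \<rho> \<longrightarrow> Q \<rho>)"
  unfolding imp_conv_disj by (intro delta_disj delta_not)

lemma delta_iff: "k \<le> 2 \<Longrightarrow> delta_pred k P \<Longrightarrow> delta_pred k Q \<Longrightarrow> delta_pred k (\<lambda>\<rho>. P \<rho> \<longleftrightarrow> Q \<rho>)"
  unfolding iff_conv_conj_imp by (intro delta_conj delta_imp)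

lemma delta_ball:
  assumes "k \<le> 2" "trm M t" "delta_pred k (\<lambda>\<rho>. P (\<rho> 0) (\<lambda>i. \<rho> (Suc i)))"
  shows "delta_pred k (\<lambda>\<rho>. \<forall>x. x \<prec> t \<rho> \<longrightarrow> P x \<rho>)"
  using sigma_ball[OF assms(1,2), of P] sigma_bex[OF assms(1,2), of "\<lambda>x \<rho>. \<not> P x \<rho>"] assms(3)
  unfolding delta_pred_def by simp

lemma delta_bex:
  assumes "k \<le> 2" "trm M t" "delta_pred k (\<lambda>\<rho>. P (\<rho> 0) (\<lambda>i. \<rho> (Suc i)))"
  shows "delta_pred k (\<lambda>\<rho>. \<exists>x. x \<prec> t \<rho> \<and> P x \<rho>)"
  using delta_not[OF delta_ball[OF assms(1,2) delta_not[OF assms(3)]]] by simp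

lemma delta_ball_le:
  assumes "k \<le> 2" "trm M t" "delta_pred k (\<lambda>\<rho>. P (\<rho> 0) (\<lambda>i. \<rho> (Suc i)))"
  shows "delta_pred k (\<lambda>\<rho>. \<forall>x. x \<preceq> t \<rho> \<longrightarrow> P x \<rho>)"
  using delta_ball[OF assms(1) trm_add[OF assms(2) trm_const[of M \<one>]] assms(3)] by (simp add: less_Suc_le)

lemma delta_bex_le:
  assumes "k \<le> 2" "trm M t" "delta_pred k (\<lambda>\<rho>. P (\<rho> 0) (\<lambda>i. \<rho> (Suc i)))"
  shows "delta_pred k (\<lambda>\<rho>. \<exists>x. x \<preceq> t \<rho> \<and> P x \<rho>)"
  using delta_bex[OF assms(1) trm_add[OF assms(2) trm_const[of M \<one>]] assms(3)] by (simp add: less_Suc_le)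

text \<open>A bounded quantifier over a value equal to \<open>t \<rho>\<close> expresses the
  substitution, which keeps the level.\<close>

lemma delta_subst:
  assumes "k \<le> 2" "delta_pred k (\<lambda>\<rho>. P (\<rho> 0) (\<lambda>i. \<rho> (Suc i)))" "trm M t"
  shows "delta_pred k (\<lambda>\<rho>. P (t \<rho>) \<rho>)"
proof -
  have "delta_pred k (\<lambda>\<rho>. \<exists>x. x \<preceq> t \<rho> \<and> x = t \<rho> \<and> P x \<rho>)"
    using assms by (intro delta_bex_le delta_conj delta_eq trm_var trm_ren[OF assms(3)])
  then show ?thesis by simp
qed

lemmas delta_intros = delta_eq delta_lt delta_le delta_mem delta_not delta_conj delta_disj delta_imp
  delta_iff delta_ball delta_bex delta_ball_le delta_bex_le

lemma sigma_delta: "delta_pred k P \<Longrightarrow> sigma M Z k P"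
  and sigma_not_delta: "delta_pred k P \<Longrightarrow> sigma M Z k (\<lambda>\<rho>. \<not> P \<rho>)"
  unfolding delta_pred_def by auto

lemma sigma_Suc_ex_delta:
  "delta_pred k (\<lambda>\<rho>. P (\<rho> 0) (\<lambda>i. \<rho> (Suc i))) \<Longrightarrow> sigma M Z (Suc k) (\<lambda>\<rho>. \<exists>x. P x \<rho>)"
  by (intro sigma_Suc_ex sigma_not_delta)

text \<open>For a \<open>\<Pi>\<close> predicate \<open>P\<close>, the absence of examples below
  \<open>n\<close> is a \<open>\<Sigma>\<close> statement of the same level, so a missing least
  example is refuted by induction on \<open>n\<close>.\<close>

lemma least_number:
  assumes "k \<le> 2" "sigma M Z k (\<lambda>\<rho>. \<not> P (\<rho> 0))" "P a"
  obtains m where "P m" "\<And>x. x \<prec> m \<Longrightarrow> \<not> P x"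
proof (rule ccontr)
  assume "\<not> thesis"
  with that have step: "P m \<Longrightarrow> \<exists>x. x \<prec> m \<and> P x" for m by blast
  have "\<forall>x. x \<prec> n \<longrightarrow> \<not> P x" for n
  proof (rule induct_le_2[OF assms(1)])
    show "sigma M Z k (\<lambda>\<rho>. \<forall>x. x \<prec> \<rho> 0 \<longrightarrow> \<not> P x)"
      using assms(1,2) by (intro sigma_ball trm_var)
    show "\<forall>x. x \<prec> n \<oplus> \<one> \<longrightarrow> \<not> P x" if "\<forall>x. x \<prec> n \<longrightarrow> \<not> P x" for n
      using that step by (auto simp: less_Suc)
  qed simp
  then show False using assms(3) less_Suc by blast
qed

end

section \<open>Coding bounded sets\<close>

text \<open>The comprehension scheme evaluates the \<open>\<Sigma>\<^sub>1\<close> and the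
  \<open>\<Pi>\<^sub>1\<close> formula under one assignment of parameters, so the two separate
  assignments are joined.\<close>

lemma (in arith_model) sets_of_delta:
  assumes comp: "Delta1_comprehension M" and A: "delta_pred 1 (\<lambda>\<rho>. \<rho> 0 \<in> A)"
  shows "A \<in> sets M"
proof -
  obtain \<phi>1 s1 \<phi>2 s2 where \<phi>: "sigma_form 1 \<phi>1" "sigma_form 1 \<phi>2"
    "\<And>\<rho>. (\<rho> 0 \<in> A) = sat M (\<lambda>_. Z) (inst s1 \<rho>) \<phi>1" "\<And>\<rho>. (\<rho> 0 \<notin> A) = sat M (\<lambda>_. Z) (inst s2 \<rho>) \<phi>2"
    using A unfolding delta_pred_def sigma_def by metis
  obtain s r1 r2 where s: "\<And>\<rho>. inst s1 \<rho> = inst s \<rho> \<circ> r1" "\<And>\<rho>. inst s2 \<rho> = inst s \<rho> \<circ> r2"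
    by (rule inst_join, rule that)
  obtain s' r where r: "\<And>x \<rho>. inst s (case_nat x \<rho>) = case_nat x (inst s' \<rho>) \<circ> r"
    by (rule inst_bind, rule that)
  obtain \<chi> where \<chi>: "pi_form 1 \<chi>" "\<And>\<sigma> \<rho>. sat M \<sigma> \<rho> \<chi> = (\<not> sat M \<sigma> \<rho> \<phi>2)"
    using sigma_pi_form_neg \<phi>(2) by metis
  let ?\<pi> = "inst s' (\<lambda>_. \<zero>)"
  have 1: "A = defset M (\<lambda>_. Z) ?\<pi> (ren_form r (ren_form r1 \<phi>1))"
    using \<phi>(3)[of "case_nat _ (\<lambda>_. \<zero>)"] by (auto simp: defset_def s r)
  have 2: "A = defset M (\<lambda>_. Z) ?\<pi> (ren_form r (ren_form r2 \<chi>))"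
    using \<phi>(4)[of "case_nat _ (\<lambda>_. \<zero>)"] by (auto simp: defset_def s r \<chi>(2))
  have "sigma_form 1 (ren_form r (ren_form r1 \<phi>1))" "pi_form 1 (ren_form r (ren_form r2 \<chi>))"
    using sigma_pi_form_ren \<phi>(1) \<chi>(1) by blast+
  moreover have "range (\<lambda>_ :: nat. Z) \<subseteq> sets M" using Z_in_sets by auto
  ultimately show ?thesis using comp 1 2 unfolding Delta1_comprehension_def by metis
qed

context arith_model
begin

section \<open>Divisibility and coprime moduli\<close>

definition dv :: "'a \<Rightarrow> 'a \<Rightarrow> bool" where
  "dv q a \<longleftrightarrow> (\<exists>c. a = q \<otimes> c)"

lemma dv_self [simp]: "dv q q"
  unfolding dv_def by (metis times_one(1))

lemma dv_times: "dv q u \<Longrightarrow> dv q (u \<otimes> v)" "dv q u \<Longrightarrow> dv q (v \<otimes> u)"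
  unfolding dv_def by (metis times_assoc times_commute)+

text \<open>In place of a subtraction, the quotients \<open>c\<close> and \<open>e\<close> are
  compared: \<open>c \<prec> e\<close> would give \<open>u \<oplus> v \<prec> u\<close>.\<close>

lemma dv_plus_cancel:
  assumes "\<zero> \<prec> q" "dv q (u \<oplus> v)" "dv q u" shows "dv q v"
proof -
  obtain c e where ce: "u \<oplus> v = q \<otimes> c" "u = q \<otimes> e" using assms(2,3) by (auto simp: dv_def)
  show ?thesis
  proof (cases "c \<prec> e")
    case True
    then have "c \<otimes> q \<prec> e \<otimes> q" using assms(1) by (rule times_less_mono1)
    with ce have "u \<oplus> v \<prec> u" by (simp add: times_commute)
    then show ?thesis using le_plus(1)[of u v] by (simp add: not_le[symmetric])
  next
    case False
    then obtain f where "c = e \<oplus> f" by (auto simp: not_less le_iff)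
    with ce have "u \<oplus> v = u \<oplus> q \<otimes> f" by (simp add: distrib_left)
    then show ?thesis by (auto simp: dv_def)
  qed
qed

lemma pos_times: "\<zero> \<prec> a \<Longrightarrow> \<zero> \<prec> b \<Longrightarrow> \<zero> \<prec> a \<otimes> b"
  using times_less_mono1[of \<zero> a b] by simp

lemma pos_Suc [simp]: "\<zero> \<prec> x \<oplus> \<one>"
  by (simp add: less_Suc_le)

lemma dv_bound: "\<zero> \<prec> a \<Longrightarrow> a = q \<otimes> c \<Longrightarrow> c \<preceq> a"
  using times_le_mono1[of \<one> q c] Suc_le[of \<zero> q] zero_le[of q] by (cases "q = \<zero>") (auto simp: le_def)

lemma dv_iff: "\<zero> \<prec> a \<Longrightarrow> dv q a \<longleftrightarrow> (\<exists>c. c \<preceq> a \<and> a = q \<otimes> c)"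
  unfolding dv_def using dv_bound by blast

text \<open>As in Goedel's beta function, the moduli \<open>(z + 1) b + 1\<close> for \<open>z < k\<close> are pairwise coprime if every
  \<open>d \<le> k\<close> divides \<open>b\<close>.\<close>

definition modulus :: "'a \<Rightarrow> 'a \<Rightarrow> 'a" where
  "modulus b z = (z \<oplus> \<one>) \<otimes> b \<oplus> \<one>"

text \<open>For positive \<open>a\<close> this is divisibility by the modulus; the bound on the
  quotient makes it a bounded formula.\<close>

definition coded :: "'a \<Rightarrow> 'a \<Rightarrow> 'a \<Rightarrow> bool" where
  "coded b a z \<longleftrightarrow> (\<exists>c. c \<preceq> a \<and> a = modulus b z \<otimes> c)"

lemma coded_iff: "\<zero> \<prec> a \<Longrightarrow> coded b a z \<longleftrightarrow> dv (modulus b z) a"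
  unfolding coded_def by (simp add: dv_iff)

lemma trm_modulus: "trm M t1 \<Longrightarrow> trm M t2 \<Longrightarrow> trm M (\<lambda>\<rho>. modulus (t1 \<rho>) (t2 \<rho>))"
  unfolding modulus_def by (intro trm_intros)

lemma delta_coded:
  assumes "trm M t1" "trm M t2" "trm M t3" shows "delta_pred k (\<lambda>\<rho>. coded (t1 \<rho>) (t2 \<rho>) (t3 \<rho>))"
proof -
  have "delta_pred 0 (\<lambda>\<rho>. coded (t1 \<rho>) (t2 \<rho>) (t3 \<rho>))"
    unfolding coded_def
    by (intro delta_bex_le delta_eq trm_modulus trm_mul trm_var assms assms[THEN trm_ren] le0)
  then show ?thesis by (rule delta_mono) simp
qed

definition common_multiple :: "'a \<Rightarrow> 'a \<Rightarrow> bool" where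
  "common_multiple k b \<longleftrightarrow> \<zero> \<prec> b \<and> (\<forall>d. d \<preceq> k \<longrightarrow> \<zero> \<prec> d \<longrightarrow> dv d b)"

lemma common_multiple_exists: "\<exists>b. common_multiple k b"
proof -
  let ?P = "\<lambda>k. \<exists>b. \<zero> \<prec> b \<and> (\<forall>d. d \<preceq> k \<longrightarrow> \<zero> \<prec> d \<longrightarrow> (\<exists>c. c \<preceq> b \<and> b = d \<otimes> c))"
  have eq: "?P k \<longleftrightarrow> (\<exists>b. common_multiple k b)" for k
    unfolding common_multiple_def by (metis dv_iff)
  have "?P k"
  proof (rule induct_1[where P = ?P])
    show "sigma M Z 1 (\<lambda>\<rho>. ?P (\<rho> 0))"
      unfolding One_nat_def
      by (intro sigma_Suc_ex_delta delta_conj delta_ball_le delta_imp delta_bex_le delta_eq delta_lt trm_intros le0)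
    show "?P \<zero>" by (auto simp: le_def intro!: exI[of _ \<one>]) (use pos_Suc[of \<zero>] in simp)
    show "?P (n \<oplus> \<one>)" if "?P n" for n
    proof -
      from that obtain b where b: "common_multiple n b" by (auto simp: eq)
      have "common_multiple (n \<oplus> \<one>) (b \<otimes> (n \<oplus> \<one>))"
        using b by (auto simp: common_multiple_def pos_times le_def[of _ "n \<oplus> \<one>"] less_Suc_le dv_times)
      then show ?thesis by (auto simp: eq)
    qed
  qed
  then show ?thesis by (simp add: eq)
qed

lemma modulus_pos [simp]: "\<zero> \<prec> modulus b z"
  by (simp add: modulus_def)

text \<open>For \<open>z \<prec> w\<close>, multiplying \<open>modulus b z\<close> by
  \<open>w \<oplus> \<one>\<close> and \<open>modulus b w\<close> by
  \<open>z \<oplus> \<one>\<close> gives numbers that differ by exactly the distance of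
  \<open>z\<close> and \<open>w\<close>; the other case is symmetric. So \<open>modulus b z\<close>
  divides this distance times \<open>x\<close>. The distance is at most \<open>k\<close> and hence
  divides \<open>b\<close>, so \<open>modulus b z\<close> divides
  \<open>(z \<oplus> \<one>) \<otimes> b \<otimes> x\<close>, which together with \<open>x\<close>
  makes a multiple of \<open>modulus b z\<close>.\<close>

lemma modulus_coprime:
  assumes b: "common_multiple k b" and zw: "z \<prec> k" "w \<prec> k" "z \<noteq> w"
    and dv: "dv (modulus b z) (modulus b w \<otimes> x)"
  shows "dv (modulus b z) x"
proof -
  have "\<exists>d. \<zero> \<prec> d \<and> d \<preceq> k \<and> dv (modulus b z) (d \<otimes> x)"
  proof (cases "z \<prec> w")
    case True
    then obtain d where d: "w = z \<oplus> d \<oplus> \<one>" by (auto simp: less_iff)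
    have "(w \<oplus> \<one>) \<otimes> modulus b z = (z \<oplus> \<one>) \<otimes> modulus b w \<oplus> (d \<oplus> \<one>)"
      unfolding d modulus_def by (simp add: semiring_simps)
    then have "(w \<oplus> \<one>) \<otimes> (modulus b z \<otimes> x) = (z \<oplus> \<one>) \<otimes> (modulus b w \<otimes> x) \<oplus> (d \<oplus> \<one>) \<otimes> x"
      by (metis distrib_right times_assoc)
    moreover have "dv (modulus b z) ((w \<oplus> \<one>) \<otimes> (modulus b z \<otimes> x))"
      by (intro dv_times(2) dv_times(1)) simp
    ultimately have "dv (modulus b z) ((d \<oplus> \<one>) \<otimes> x)"
      using dv_plus_cancel[OF modulus_pos] dv_times(2)[OF dv] by metis
    moreover have "d \<oplus> \<one> \<preceq> k"
      using zw(2) le_plus(2)[of "d \<oplus> \<one>" z] unfolding d plus_assoc by order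
    ultimately show ?thesis using pos_Suc by blast
  next
    case False
    with zw obtain d where d: "z = w \<oplus> d \<oplus> \<one>" by (metis less_iff less_linear)
    have "(z \<oplus> \<one>) \<otimes> modulus b w = (w \<oplus> \<one>) \<otimes> modulus b z \<oplus> (d \<oplus> \<one>)"
      unfolding d modulus_def by (simp add: semiring_simps)
    then have "(z \<oplus> \<one>) \<otimes> (modulus b w \<otimes> x) = (w \<oplus> \<one>) \<otimes> (modulus b z \<otimes> x) \<oplus> (d \<oplus> \<one>) \<otimes> x"
      by (metis distrib_right times_assoc)
    moreover have "dv (modulus b z) ((w \<oplus> \<one>) \<otimes> (modulus b z \<otimes> x))"
      by (intro dv_times(2) dv_times(1)) simp
    ultimately have "dv (modulus b z) ((d \<oplus> \<one>) \<otimes> x)"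
      using dv_plus_cancel[OF modulus_pos] dv_times(2)[OF dv] by metis
    moreover have "d \<oplus> \<one> \<preceq> k"
      using zw(1) le_plus(2)[of "d \<oplus> \<one>" w] unfolding d plus_assoc by order
    ultimately show ?thesis using pos_Suc by blast
  qed
  then obtain d where d: "\<zero> \<prec> d" "d \<preceq> k" "dv (modulus b z) (d \<otimes> x)" by blast
  with b obtain e where "b = d \<otimes> e" by (auto simp: common_multiple_def dv_def)
  then have "(z \<oplus> \<one>) \<otimes> b \<otimes> x = (z \<oplus> \<one>) \<otimes> e \<otimes> (d \<otimes> x)" by (simp add: semiring_simps)
  with d(3) have "dv (modulus b z) ((z \<oplus> \<one>) \<otimes> b \<otimes> x)" by (simp add: dv_times(2))
  moreover have "dv (modulus b z) ((z \<oplus> \<one>) \<otimes> b \<otimes> x \<oplus> x)"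
    using dv_times(1)[OF dv_self, of "modulus b z" x] by (simp add: modulus_def distrib_right)
  ultimately show ?thesis by (rule dv_plus_cancel[OF modulus_pos, rotated])
qed

lemma modulus_multiple: "\<exists>a. \<zero> \<prec> a \<and> (\<forall>z. z \<prec> k \<longrightarrow> coded b a z)"
proof (rule induct_1[where P = "\<lambda>k. \<exists>a. \<zero> \<prec> a \<and> (\<forall>z. z \<prec> k \<longrightarrow> coded b a z)"])
  show "sigma M Z 1 (\<lambda>\<rho>. \<exists>a. \<zero> \<prec> a \<and> (\<forall>z. z \<prec> \<rho> 0 \<longrightarrow> coded b a z))"
    unfolding One_nat_def
    by (intro sigma_Suc_ex_delta delta_conj delta_ball delta_lt delta_coded trm_intros le0)
  show "\<exists>a. \<zero> \<prec> a \<and> (\<forall>z. z \<prec> \<zero> \<longrightarrow> coded b a z)"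
    using pos_Suc[of \<zero>] by (intro exI[of _ \<one>]) simp
  show "\<exists>a. \<zero> \<prec> a \<and> (\<forall>z. z \<prec> n \<oplus> \<one> \<longrightarrow> coded b a z)"
    if "\<exists>a. \<zero> \<prec> a \<and> (\<forall>z. z \<prec> n \<longrightarrow> coded b a z)" for n
  proof -
    from that obtain a where "\<zero> \<prec> a" "\<forall>z. z \<prec> n \<longrightarrow> coded b a z" by blast
    then show ?thesis
      by (intro exI[of _ "a \<otimes> modulus b n"]) (auto simp: pos_times coded_iff less_Suc dv_times)
  qed
qed

text \<open>The code is the least common multiple of the moduli \<open>modulus b z\<close> with \<open>P z\<close>, which is divisible
  by no other modulus.\<close>

lemma bounded_comprehension:
  assumes b: "common_multiple k b" and P: "sigma M Z 2 (\<lambda>\<rho>. P (\<rho> 0))"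
  obtains a where "\<And>z. z \<prec> k \<Longrightarrow> coded b a z \<longleftrightarrow> P z"
proof -
  let ?R = "\<lambda>a. \<zero> \<prec> a \<and> (\<forall>z. z \<prec> k \<longrightarrow> P z \<longrightarrow> coded b a z)"
  \<comment> \<open>As \<open>P\<close> occurs negatively, \<open>?R\<close> is
    \<open>\<Pi>\<^sub>2\<close>, which is what \<open>least_number\<close> asks for.\<close>
  have sub: "sigma M Z 2 (\<lambda>\<rho>. \<not> \<zero> \<prec> \<rho> 0 \<or> (\<exists>z. z \<prec> k \<and> P z \<and> \<not> coded b (\<rho> 0) z))"
    by (intro sigma_disj sigma_bex sigma_conj sigma_not_delta delta_lt delta_coded trm_intros P Nat.le_refl)
  obtain a0 where "?R a0" using modulus_multiple by blast
  obtain a where a: "?R a" "\<And>x. x \<prec> a \<Longrightarrow> \<not> ?R x"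
  proof (rule least_number[of 2 ?R a0])
    show "sigma M Z 2 (\<lambda>\<rho>. \<not> ?R (\<rho> 0))" using sub by (simp add: not_less imp_conjL)
  qed (use \<open>?R a0\<close> in auto)
  have "P w" if w: "w \<prec> k" "coded b a w" for w
  proof (rule ccontr)
    \<comment> \<open>Divide \<open>a\<close> by the modulus of \<open>w\<close>. By coprimality the
      quotient \<open>c\<close> is still a multiple of all required moduli, and \<open>b\<close>
      being positive makes the modulus larger than 1, so \<open>c\<close> contradicts the minimality
      of \<open>a\<close>.\<close>
    assume "\<not> P w"
    obtain c where c: "a = modulus b w \<otimes> c" using w(2) by (auto simp: coded_def)
    have c0: "\<zero> \<prec> c" using a(1) c zero_le[of c] by (auto simp: le_def)
    have "\<zero> \<prec> b" using b by (simp add: common_multiple_def)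
    then have "\<one> \<prec> modulus b w" using plus_less_mono1[OF pos_times[OF pos_Suc]] by (fastforce simp: modulus_def)
    from times_less_mono1[OF this c0] have "c \<prec> a" by (simp add: c)
    moreover have "coded b c z" if "z \<prec> k" "P z" for z
    proof -
      have "z \<noteq> w" using that(2) \<open>\<not> P w\<close> by auto
      moreover have "dv (modulus b z) (modulus b w \<otimes> c)" using a(1) that coded_iff[of a b z] unfolding c[symmetric] by blast
      ultimately show ?thesis using modulus_coprime[OF b that(1) w(1)] c0 by (simp add: coded_iff)
    qed
    ultimately show False using a(2) c0 by blast
  qed
  with a(1) show thesis using that by blast
qed

text \<open>The elements are enumerated as \<open>y\<close> runs through the numbers below
  \<open>e\<close>. By \<open>unique\<close> each stage contributes at most one element, so the
  count never exceeds the number of stages. Taking \<open>P\<close> to be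
  \<open>\<Delta>\<^sub>1\<close> keeps this within \<open>\<Sigma>\<^sub>2\<close>
  induction.\<close>

lemma card_le_of_relation:
  assumes comp: "Delta1_comprehension M"
    and P: "delta_pred 1 (\<lambda>\<rho>. P (\<rho> 0) (\<rho> (Suc 0)))"
    and unique: "\<And>v v' y. P v y \<Longrightarrow> P v' y \<Longrightarrow> v = v'"
    and bound: "\<And>v y. P v y \<Longrightarrow> v \<prec> V"
  shows "card_le M {v. \<exists>y. y \<prec> e \<and> P v y} e"
proof -
  have "\<exists>b. common_multiple (pair M e V) b" by (rule common_multiple_exists)
  then obtain b where b: "common_multiple (pair M e V) b" by blast
  have pair_less: "pair M i v \<prec> pair M e V" if "i \<prec> e" "v \<prec> V" for i v
    using that pair_mono[of i e v V] pair_inj[of i v e V] by (auto simp: le_def)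
  \<comment> \<open>The code \<open>a\<close> describes a bijection from the numbers below
    \<open>m\<close> to the elements found before stage \<open>n\<close>. The clauses give totality
    with correct values, single-valuedness, injectivity and surjectivity.\<close>
  define B where "B a m n \<longleftrightarrow>
    (\<forall>i. i \<prec> m \<longrightarrow> (\<exists>v. v \<prec> V \<and> coded b a (pair M i v) \<and> (\<exists>y. y \<prec> n \<and> P v y))) \<and>
    (\<forall>i. i \<prec> m \<longrightarrow> (\<forall>v. v \<prec> V \<longrightarrow> (\<forall>v'. v' \<prec> V \<longrightarrow>
       coded b a (pair M i v) \<longrightarrow> coded b a (pair M i v') \<longrightarrow> v = v'))) \<and>
    (\<forall>i. i \<prec> m \<longrightarrow> (\<forall>i'. i' \<prec> m \<longrightarrow> (\<forall>v. v \<prec> V \<longrightarrow>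
       coded b a (pair M i v) \<longrightarrow> coded b a (pair M i' v) \<longrightarrow> i = i'))) \<and>
    (\<forall>v. v \<prec> V \<longrightarrow> (\<exists>y. y \<prec> n \<and> P v y) \<longrightarrow> (\<exists>i. i \<prec> m \<and> coded b a (pair M i v)))" for a m n
  \<comment> \<open>Up to \<open>e\<close> all pairs stay in the range for which \<open>b\<close>
    was chosen; beyond it the guard makes the claim vacuous. With \<open>a\<close> quantified in
    front, the statement is visibly \<open>\<Sigma>\<^sub>2\<close>.\<close>
  let ?C = "\<lambda>n. \<exists>a. n \<preceq> e \<longrightarrow> (\<exists>m. m \<preceq> n \<and> B a m n)"
  have "?C e"
  proof (rule induct_le_2[where P = ?C and k = 2])
    have P': "delta_pred 1 (\<lambda>\<rho>. P (\<rho> i) (\<rho> j))" for i j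
      using P sigma_ren[where r = "case_nat i (\<lambda>_. j)", of M Z 1 "\<lambda>\<rho>. P (\<rho> 0) (\<rho> (Suc 0))"]
        sigma_ren[where r = "case_nat i (\<lambda>_. j)", of M Z 1 "\<lambda>\<rho>. \<not> P (\<rho> 0) (\<rho> (Suc 0))"]
      by (simp add: delta_pred_def)
    show "sigma M Z 2 (\<lambda>\<rho>. ?C (\<rho> 0))"
      unfolding B_def numeral_2_eq_2
      by (intro sigma_Suc_ex_delta delta_intros delta_coded trm_intros P'[unfolded One_nat_def]) simp_all
    show "?C \<zero>" by (auto simp: B_def intro!: exI[of _ \<zero>])
    show "?C (n \<oplus> \<one>)" if "?C n" for n
    proof (cases "n \<prec> e")
      case False
      then show ?thesis by (simp add: Suc_le)
    next
      case True
      with that obtain a m where m: "m \<preceq> n" "B a m n" by (auto simp: le_def)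
      show ?thesis
      proof (cases "\<exists>v. P v n \<and> \<not> (\<exists>y. y \<prec> n \<and> P v y)")
        case False
        then have "(\<exists>y. y \<prec> n \<oplus> \<one> \<and> P v y) \<longleftrightarrow> (\<exists>y. y \<prec> n \<and> P v y)" for v
          by (auto simp: less_Suc)
        then have "B a m (n \<oplus> \<one>)" using m(2) unfolding B_def by simp
        then show ?thesis using m(1) less_Suc_le order.strict_implies_order by blast
      next
        case True
        then obtain v where v: "P v n" "\<not> (\<exists>y. y \<prec> n \<and> P v y)" by blast
        \<comment> \<open>The old enumeration with the new element \<open>v\<close> appended at
          position \<open>m\<close>.\<close>
        let ?G = "\<lambda>z. (\<exists>i. i \<prec> m \<and> (\<exists>v. v \<prec> V \<and> z = pair M i v \<and> coded b a z)) \<or> z = pair M m v"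
        have "delta_pred 2 (\<lambda>\<rho>. ?G (\<rho> 0))"
          by (intro delta_intros delta_coded trm_intros) simp_all
        from bounded_comprehension[OF b sigma_delta[OF this]]
        obtain a' where a': "\<And>z. z \<prec> pair M e V \<Longrightarrow> coded b a' z \<longleftrightarrow> ?G z" by blast
        have me: "m \<prec> e" using m(1) \<open>n \<prec> e\<close> by order
        have code: "coded b a' (pair M i w) \<longleftrightarrow> (i \<prec> m \<and> coded b a (pair M i w)) \<or> (i = m \<and> w = v)"
          if "i \<prec> m \<oplus> \<one>" "w \<prec> V" for i w
          using a'[OF pair_less[of i w]] that me less_trans[of i m e] by (auto simp: less_Suc)
        have vV: "v \<prec> V" using bound v(1) by blast
        have new: "\<not> coded b a (pair M i v)" if "i \<prec> m" for i
          using m(2) v(2) vV that unfolding B_def by metis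
        have dom: "(\<exists>y. y \<prec> n \<oplus> \<one> \<and> P w y) \<longleftrightarrow> (\<exists>y. y \<prec> n \<and> P w y) \<or> w = v" for w
          using v(1) unique by (auto simp: less_Suc)
        have "B a' (m \<oplus> \<one>) (n \<oplus> \<one>)"
          unfolding B_def dom
        proof (intro conjI allI impI)
          fix i assume "i \<prec> m \<oplus> \<one>"
          then show "\<exists>w. w \<prec> V \<and> coded b a' (pair M i w) \<and> ((\<exists>y. y \<prec> n \<and> P w y) \<or> w = v)"
            using code[OF \<open>i \<prec> m \<oplus> \<one>\<close>] m(2) vV unfolding B_def less_Suc by metis
        next
          fix i w w' assume "i \<prec> m \<oplus> \<one>" "w \<prec> V" "w' \<prec> V"
            "coded b a' (pair M i w)" "coded b a' (pair M i w')"
          then show "w = w'" using code m(2) unfolding B_def by (metis less_irrefl)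
        next
          fix i i' w assume "i \<prec> m \<oplus> \<one>" "i' \<prec> m \<oplus> \<one>" "w \<prec> V"
            "coded b a' (pair M i w)" "coded b a' (pair M i' w)"
          then show "i = i'" using code new m(2) unfolding B_def by metis
        next
          fix w assume "w \<prec> V" "(\<exists>y. y \<prec> n \<and> P w y) \<or> w = v"
          then show "\<exists>i. i \<prec> m \<oplus> \<one> \<and> coded b a' (pair M i w)"
            using code[OF _ \<open>w \<prec> V\<close>] m(2) unfolding B_def less_Suc by metis
        qed
        then show ?thesis using m(1) plus_le_cancel(1)[of m \<one> n] by blast
      qed
    qed
  qed simp
  then obtain a m where m: "m \<preceq> e" "B a m e" by blast
  define g where "g i = (THE v. v \<prec> V \<and> coded b a (pair M i v))" for i
  have g: "v \<prec> V \<and> coded b a (pair M i v) \<longleftrightarrow> v = g i" if "i \<prec> m" for i v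
  proof -
    have ex1: "\<exists>!v. v \<prec> V \<and> coded b a (pair M i v)"
      using m(2) that unfolding B_def by blast
    from theI'[OF ex1] have "g i \<prec> V \<and> coded b a (pair M i (g i))" unfolding g_def .
    with ex1 show ?thesis by blast
  qed
  \<comment> \<open>Although the code was found by \<open>\<Sigma>\<^sub>2\<close> induction, the
    graph is defined from it by bounded quantifiers, so \<open>\<Delta>\<^sub>1\<close>
    comprehension puts it into the model.\<close>
  have "graph1 M {i. i \<prec> m} g = {z. \<exists>i. i \<prec> m \<and> (\<exists>v. v \<prec> V \<and> z = pair M i v \<and> coded b a z)}"
  proof (intro set_eqI iffI)
    fix z assume "z \<in> graph1 M {i. i \<prec> m} g"
    then obtain i where "i \<prec> m" "z = pair M i (g i)" by (auto simp: graph1_def)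
    then show "z \<in> {z. \<exists>i. i \<prec> m \<and> (\<exists>v. v \<prec> V \<and> z = pair M i v \<and> coded b a z)}"
      using g[of i "g i"] by auto
  next
    fix z assume "z \<in> {z. \<exists>i. i \<prec> m \<and> (\<exists>v. v \<prec> V \<and> z = pair M i v \<and> coded b a z)}"
    then obtain i v where "i \<prec> m" "v \<prec> V" "z = pair M i v" "coded b a z" by auto
    then show "z \<in> graph1 M {i. i \<prec> m} g"
      using g[of i v] by (auto simp: graph1_def)
  qed
  moreover have "delta_pred 1 (\<lambda>\<rho>. \<rho> 0 \<in> {z. \<exists>i. i \<prec> m \<and> (\<exists>v. v \<prec> V \<and> z = pair M i v \<and> coded b a z)})"
    unfolding mem_Collect_eq by (intro delta_intros delta_coded trm_intros) simp_all
  ultimately have graph: "graph1 M {i. i \<prec> m} g \<in> sets M" using sets_of_delta[OF comp] by simp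
  have "bij_betw g {i. i \<prec> m} {v. \<exists>y. y \<prec> e \<and> P v y}"
    unfolding bij_betw_def
  proof
    show "inj_on g {i. i \<prec> m}"
      using g m(2) unfolding B_def inj_on_def by (metis mem_Collect_eq)
    show "g ` {i. i \<prec> m} = {v. \<exists>y. y \<prec> e \<and> P v y}"
    proof (intro set_eqI iffI)
      fix v assume "v \<in> g ` {i. i \<prec> m}"
      then obtain i where i: "i \<prec> m" "v = g i" by blast
      obtain w where "w \<prec> V \<and> coded b a (pair M i w)" "\<exists>y. y \<prec> e \<and> P w y"
        using m(2) i(1) unfolding B_def by blast
      then show "v \<in> {v. \<exists>y. y \<prec> e \<and> P v y}" using g[OF i(1)] i(2) by simp
    next
      fix v assume "v \<in> {v. \<exists>y. y \<prec> e \<and> P v y}"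
      then have "\<exists>y. y \<prec> e \<and> P v y" "v \<prec> V" using bound by auto
      then obtain i where "i \<prec> m" "coded b a (pair M i v)" using m(2) unfolding B_def by blast
      then show "v \<in> g ` {i. i \<prec> m}" using g \<open>v \<prec> V\<close> by blast
    qed
  qed
  with graph m(1) show ?thesis unfolding card_le_def has_card_def le_def by blast
qed

end

section \<open>Colorings and the family of finite sets\<close>

locale stable_coloring = arith_model +
  fixes f :: "'a \<Rightarrow> 'a \<Rightarrow> 'a"
  assumes comprehension: "Delta1_comprehension M"
    and computable_f: "computable_coloring M f"
    and stable: "weakly_rainbow_stable M f"
    and bounded: "two_bounded M f"
begin

definition eqc :: "'a \<Rightarrow> 'a \<Rightarrow> 'a \<Rightarrow> 'a \<Rightarrow> bool" where
  "eqc x s y t \<longleftrightarrow> x \<prec> s \<and> y \<prec> t \<and> f x s = f y t"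

abbreviation f_graph where "f_graph \<equiv> graph2 M (pairs_of M UNIV) f"

lemma pair_in_f_graph: "pair M (pair M x s) c \<in> f_graph \<longleftrightarrow> x \<prec> s \<and> c = f x s"
  unfolding graph2_def pairs_of_def by auto

lemma delta_f_graph:
  assumes "trm M t" shows "delta_pred (Suc 0) (\<lambda>\<rho>. t \<rho> \<in> f_graph)"
proof -
  have "delta_pred (Suc 0) (\<lambda>\<rho>. \<rho> 0 \<in> f_graph)"
  proof -
    obtain \<phi> \<pi> \<psi> \<pi>' where "sigma_form (Suc 0) \<phi>" "f_graph = defset M (\<lambda>_. {}) \<pi> \<phi>"
      "pi_form (Suc 0) \<psi>" "f_graph = defset M (\<lambda>_. {}) \<pi>' \<psi>"
      using computable_f
      unfolding computable_coloring_def computable_def computes_def delta_in_def One_nat_def by blast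
    then show ?thesis
      unfolding delta_pred_def by (intro conjI sigma_of_defset sigma_not_of_defset)
  qed
  then show ?thesis
    by (rule delta_subst[where P = "\<lambda>x _. x \<in> f_graph", rotated]) (simp_all add: assms)
qed

text \<open>Since \<open>f\<close> has a value on every increasing pair, equality and inequality of
  colors are both witnessed by the color of one side; this makes \<open>eqc\<close>
  \<open>\<Delta>\<^sub>1\<close>.\<close>

lemma eqc_iff: "eqc x s y t \<longleftrightarrow> (\<exists>c. pair M (pair M x s) c \<in> f_graph \<and> pair M (pair M y t) c \<in> f_graph)"
  and not_eqc_iff: "\<not> eqc x s y t \<longleftrightarrow> \<not> x \<prec> s \<or> \<not> y \<prec> t \<or>
    (\<exists>c. pair M (pair M x s) c \<in> f_graph \<and> pair M (pair M y t) c \<notin> f_graph)"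
  unfolding pair_in_f_graph eqc_def by auto

lemma delta_eqc:
  assumes "trm M t1" "trm M t2" "trm M t3" "trm M t4"
  shows "delta_pred (Suc 0) (\<lambda>\<rho>. eqc (t1 \<rho>) (t2 \<rho>) (t3 \<rho>) (t4 \<rho>))"
  unfolding delta_pred_def
proof
  show "sigma M Z (Suc 0) (\<lambda>\<rho>. eqc (t1 \<rho>) (t2 \<rho>) (t3 \<rho>) (t4 \<rho>))"
    unfolding eqc_iff
    by (intro sigma_ex sigma_delta delta_conj delta_f_graph trm_pair trm_var assms[THEN trm_ren]) simp_all
  show "sigma M Z (Suc 0) (\<lambda>\<rho>. \<not> eqc (t1 \<rho>) (t2 \<rho>) (t3 \<rho>) (t4 \<rho>))"
    unfolding not_eqc_iff
    by (intro sigma_disj sigma_not_delta[OF delta_lt] assms sigma_ex sigma_delta[OF delta_conj] delta_not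
        delta_f_graph trm_pair trm_var assms[THEN trm_ren]) simp_all
qed

definition partner :: "'a \<Rightarrow> 'a \<Rightarrow> bool" where
  "partner x y \<longleftrightarrow> (\<exists>b. \<forall>s. b \<prec> s \<longrightarrow> eqc x s y s)"

text \<open>Weak stability enters here: failing to be eventually equal becomes being eventually
  different, which has the same \<open>\<Sigma>\<^sub>2\<close> form as \<open>partner\<close>
  itself.\<close>

lemma not_partner_iff: "\<not> partner x y \<longleftrightarrow> (\<exists>b. \<forall>s. b \<prec> s \<longrightarrow> \<not> eqc x s y s)"
proof
  assume "\<not> partner x y"
  have "\<not> finite_in M {s. x \<prec> s \<and> y \<prec> s \<and> f x s \<noteq> f y s}"
  proof
    assume "finite_in M {s. x \<prec> s \<and> y \<prec> s \<and> f x s \<noteq> f y s}"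
    then obtain b where b: "\<And>s. x \<prec> s \<Longrightarrow> y \<prec> s \<Longrightarrow> f x s \<noteq> f y s \<Longrightarrow> s \<prec> b"
      by (auto simp: finite_in_def)
    \<comment> \<open>Adding \<open>x \<oplus> y\<close> to the bound forces \<open>s\<close> above
      \<open>x\<close> and \<open>y\<close>, as \<open>eqc\<close> demands.\<close>
    have "eqc x s y s" if "b \<oplus> (x \<oplus> y) \<prec> s" for s
    proof -
      have "b \<prec> s" "x \<oplus> y \<prec> s" using that le_plus[of b "x \<oplus> y"] le_plus[of "x \<oplus> y" b] by order+
      moreover have "x \<prec> s" "y \<prec> s" using \<open>x \<oplus> y \<prec> s\<close> le_plus[of x y] le_plus[of y x] by order+
      ultimately show ?thesis using b[of s] unfolding eqc_def by (meson less_asym)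
    qed
    then show False using \<open>\<not> partner x y\<close> unfolding partner_def by blast
  qed
  with stable have "finite_in M {s. x \<prec> s \<and> y \<prec> s \<and> f x s = f y s}"
    unfolding weakly_rainbow_stable_def by blast
  then obtain b where "\<And>s. eqc x s y s \<Longrightarrow> s \<prec> b" unfolding eqc_def by (auto simp: finite_in_def)
  then show "\<exists>b. \<forall>s. b \<prec> s \<longrightarrow> \<not> eqc x s y s" using less_asym by blast
next
  assume "\<exists>b. \<forall>s. b \<prec> s \<longrightarrow> \<not> eqc x s y s"
  then obtain b where b: "\<And>s. b \<prec> s \<Longrightarrow> \<not> eqc x s y s" by blast
  show "\<not> partner x y"
  proof
    assume "partner x y"
    then obtain c where c: "\<And>s. c \<prec> s \<Longrightarrow> eqc x s y s" unfolding partner_def by blast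
    show False using b[of "b \<oplus> c \<oplus> \<one>"] c[of "b \<oplus> c \<oplus> \<one>"] by (simp add: less_Suc_le)
  qed
qed

lemma sigma_2_eventually:
  assumes "delta_pred (Suc 0) (\<lambda>\<rho>. P (\<rho> 0) (\<lambda>i. \<rho> (Suc i)))" "trm M t"
  shows "sigma M Z (Suc (Suc 0)) (\<lambda>\<rho>. \<forall>s. t \<rho> \<prec> s \<longrightarrow> P s \<rho>)"
proof -
  have "sigma M Z (Suc 0) (\<lambda>\<rho>. \<exists>s. t \<rho> \<prec> s \<and> \<not> P s \<rho>)"
    by (intro sigma_ex sigma_delta[OF delta_conj] delta_lt delta_not assms(1) trm_var trm_ren[OF assms(2)]) simp_all
  then show ?thesis by - (rule sigma_Suc_of_not, simp)
qed

lemma delta_partner: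
  assumes "trm M t1" "trm M t2"
  shows "delta_pred (Suc (Suc 0)) (\<lambda>\<rho>. partner (t1 \<rho>) (t2 \<rho>))"
  unfolding delta_pred_def
proof
  show "sigma M Z (Suc (Suc 0)) (\<lambda>\<rho>. partner (t1 \<rho>) (t2 \<rho>))"
    unfolding partner_def
    by (intro sigma_ex sigma_2_eventually delta_eqc trm_var assms[THEN trm_ren, THEN trm_ren]) simp
  show "sigma M Z (Suc (Suc 0)) (\<lambda>\<rho>. \<not> partner (t1 \<rho>) (t2 \<rho>))"
    unfolding not_partner_iff
    by (intro sigma_ex sigma_2_eventually delta_not delta_eqc trm_var assms[THEN trm_ren, THEN trm_ren]) simp
qed

text \<open>Beyond both bounds the pairs of \<open>x\<close>, \<open>x'\<close> and \<open>y\<close>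
  with \<open>s\<close> share a color, one pair more than 2-boundedness permits.\<close>

lemma partner_unique:
  assumes "partner x y" "partner x' y" "x \<noteq> y" "x' \<noteq> y" shows "x = x'"
proof (rule ccontr)
  assume "x \<noteq> x'"
  obtain b where b: "\<And>s. b \<prec> s \<Longrightarrow> eqc x s y s" using assms(1) unfolding partner_def by blast
  obtain c where c: "\<And>s. c \<prec> s \<Longrightarrow> eqc x' s y s" using assms(2) unfolding partner_def by blast
  define s where "s = b \<oplus> c \<oplus> \<one>"
  have eq: "eqc x s y s" "eqc x' s y s" using b c by (simp_all add: s_def less_Suc_le)
  define P where "P = {(z, t) \<in> pairs_of M UNIV. f z t = f y s}"
  have P: "finite P" "card P \<le> 2"
    using bounded unfolding two_bounded_def P_def Let_def by blast+
  have "{(x, s), (x', s), (y, s)} \<subseteq> P" using eq by (auto simp: P_def pairs_of_def eqc_def)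
  from card_mono[OF P(1) this] P(2) \<open>x \<noteq> x'\<close> assms(3,4) show False by simp
qed

text \<open>2-boundedness counts preimages in the metatheory, so their second entries have a genuine
  maximum; inserting \<open>\<zero>\<close> keeps the set nonempty.\<close>

lemma color_bounded: "\<exists>u. \<forall>x s. u \<prec> s \<longrightarrow> \<not> eqc x s y t"
proof -
  let ?P = "{(x, s) \<in> pairs_of M UNIV. f x s = f y t}"
  have "finite ?P" using bounded unfolding two_bounded_def Let_def by blast
  then have "finite (insert \<zero> (snd ` ?P))" by simp
  then have ge: "s \<preceq> Max (insert \<zero> (snd ` ?P))" if "s \<in> insert \<zero> (snd ` ?P)" for s
    using that by (rule Max_ge)
  have "\<not> eqc x s y t" if "Max (insert \<zero> (snd ` ?P)) \<prec> s" for x s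
  proof
    assume "eqc x s y t"
    then have "(x, s) \<in> ?P" by (auto simp: eqc_def pairs_of_def)
    then have "s \<in> insert \<zero> (snd ` ?P)" by force
    from ge[OF this] that show False by order
  qed
  then show ?thesis by blast
qed

section \<open>The family of finite sets\<close>

definition partner_family :: "'a \<Rightarrow> 'a set" where
  "partner_family e = {v. \<exists>y. y \<prec> e \<and> partner (pair M e v) y}"

text \<open>\<open>partner_unique\<close> excludes the trivial partner \<open>y\<close> itself; this
  is ensured by \<open>pair M e v\<close> being at least \<open>e\<close> and thus different from
  \<open>y\<close>.\<close>

lemma partner_pair_unique: "partner (pair M e v) y \<Longrightarrow> partner (pair M e v') y \<Longrightarrow> y \<prec> e \<Longrightarrow> v = v'"
  using partner_unique[of "pair M e v" y "pair M e v'"] le_pair(1)[of e v] le_pair(1)[of e v']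
  by (auto simp: not_le[symmetric])

text \<open>Collection needs a witness for every \<open>y \<prec> e\<close>, but some
  \<open>y\<close> may have none. The \<open>\<Sigma>\<^sub>2\<close> set of those that have one is
  therefore coded by a number first; the implication from the code to \<open>partner\<close> is then
  total and still \<open>\<Delta>\<^sub>2\<close>.\<close>

lemma partner_family_bounded: "\<exists>V. \<forall>v y. y \<prec> e \<longrightarrow> partner (pair M e v) y \<longrightarrow> v \<prec> V"
proof -
  obtain b where b: "common_multiple e b" using common_multiple_exists by blast
  have "sigma M Z 2 (\<lambda>\<rho>. \<exists>v. partner (pair M e v) (\<rho> 0))"
    unfolding numeral_2_eq_2 by (intro sigma_ex sigma_delta delta_partner trm_intros) simp
  from bounded_comprehension[OF b this]
  obtain a where a: "\<And>y. y \<prec> e \<Longrightarrow> coded b a y \<longleftrightarrow> (\<exists>v. partner (pair M e v) y)" by blast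
  have "sigma M Z (Suc (Suc 0)) (\<lambda>\<rho>. coded b a (\<rho> (Suc 0)) \<longrightarrow> partner (pair M e (\<rho> 0)) (\<rho> (Suc 0)))"
    by (intro sigma_delta delta_imp delta_coded delta_partner trm_intros) simp
  from collection[OF _ this, of e] obtain w where
    w: "\<And>y. y \<prec> e \<Longrightarrow> \<exists>v. v \<prec> w \<and> (coded b a y \<longrightarrow> partner (pair M e v) y)"
    using a by (auto simp: numeral_2_eq_2)
  have "v \<prec> w" if "y \<prec> e" "partner (pair M e v) y" for v y
    using w[OF that(1)] a[OF that(1)] partner_pair_unique[OF that(2) _ that(1)] that(2) by blast
  then show ?thesis by blast
qed

lemma finite_partner_family: "finite_in M (partner_family e)"
  using partner_family_bounded[of e] unfolding finite_in_def partner_family_def by blast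

text \<open>\<open>card_le_of_relation\<close> wants a \<open>\<Delta>\<^sub>1\<close> relation,
  whereas \<open>partner\<close> is \<open>\<Delta>\<^sub>2\<close>. Its restriction to
  \<open>v \<prec> V\<close> and \<open>y \<prec> e\<close> has a code \<open>a\<close>, and
  membership in the code is a bounded formula.\<close>

lemma card_partner_family: "card_le M (partner_family e) e"
proof -
  obtain V where V: "\<And>v y. y \<prec> e \<Longrightarrow> partner (pair M e v) y \<Longrightarrow> v \<prec> V"
    using partner_family_bounded by blast
  obtain b where b: "common_multiple (pair M V e) b" using common_multiple_exists by blast
  have "delta_pred 2 (\<lambda>\<rho>. \<exists>v. v \<prec> V \<and> (\<exists>y. y \<prec> e \<and> \<rho> 0 = pair M v y \<and> partner (pair M e v) y))"
    unfolding numeral_2_eq_2 by (intro delta_intros delta_partner trm_intros) simp_all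
  from bounded_comprehension[OF b sigma_delta[OF this]] obtain a where
    a: "\<And>z. z \<prec> pair M V e \<Longrightarrow> coded b a z \<longleftrightarrow> (\<exists>v. v \<prec> V \<and> (\<exists>y. y \<prec> e \<and> z = pair M v y \<and> partner (pair M e v) y))"
    by blast
  define P where "P v y \<longleftrightarrow> v \<prec> V \<and> y \<prec> e \<and> coded b a (pair M v y)" for v y
  have P: "P v y \<longleftrightarrow> y \<prec> e \<and> partner (pair M e v) y" for v y
  proof -
    have "pair M v y \<prec> pair M V e" if "v \<prec> V" "y \<prec> e"
      using that pair_mono[of v V y e] pair_inj[of v y V e] by (auto simp: le_def)
    then show ?thesis unfolding P_def using a V by auto
  qed
  have "card_le M {v. \<exists>y. y \<prec> e \<and> P v y} e"
  proof (rule card_le_of_relation[OF comprehension])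
    show "delta_pred 1 (\<lambda>\<rho>. P (\<rho> 0) (\<rho> (Suc 0)))"
      unfolding P_def by (intro delta_intros delta_coded trm_intros) simp_all
    show "v = v'" if "P v y" "P v' y" for v v' y using that partner_pair_unique unfolding P by blast
    show "v \<prec> V" if "P v y" for v y using that by (simp add: P_def)
  qed
  then show ?thesis unfolding P partner_family_def by simp
qed

lemma delta_partner_family: "delta_pred 2 (\<lambda>\<rho>. \<rho> 0 \<in> {pair M x e |x e. x \<in> partner_family e})"
proof -
  have "z \<in> {pair M x e |x e. x \<in> partner_family e} \<longleftrightarrow>
    (\<exists>x. x \<preceq> z \<and> (\<exists>e. e \<preceq> z \<and> z = pair M x e \<and> (\<exists>y. y \<prec> e \<and> partner (pair M e x) y)))" for z
    unfolding partner_family_def using le_pair by auto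
  moreover have "delta_pred 2 (\<lambda>\<rho>.
    (\<exists>x. x \<preceq> \<rho> 0 \<and> (\<exists>e. e \<preceq> \<rho> 0 \<and> \<rho> 0 = pair M x e \<and> (\<exists>y. y \<prec> e \<and> partner (pair M e x) y))))"
    unfolding numeral_2_eq_2 by (intro delta_intros delta_partner trm_intros) simp_all
  ultimately show ?thesis by simp
qed

end

section \<open>The rainbow computed by an escaping function\<close>

locale escaping_function = stable_coloring +
  fixes h :: "'a \<Rightarrow> 'a \<Rightarrow> 'a"
  assumes Z_eq: "Z = graph2 M UNIV h"
    and escaping: "escaping M partner_family h"
begin

definition key :: "'a \<Rightarrow> 'a" where
  "key e = pair M e (h e e)"

lemma le_key: "e \<preceq> key e"
  unfolding key_def by (rule le_pair)

lemma key_not_partner: "y \<prec> e \<Longrightarrow> \<not> partner (key e) y"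
  using escaping card_partner_family[of e] unfolding escaping_def partner_family_def key_def by blast

text \<open>The value of \<open>h\<close> is bounded by the pair containing it, so the graph of
  \<open>key\<close> is definable from \<open>Z\<close> with bounded quantifiers.\<close>

lemma key_iff: "x = key e \<longleftrightarrow> (\<exists>c. c \<preceq> x \<and> x = pair M e c \<and> pair M (pair M e e) c \<in> Z)"
  unfolding key_def Z_eq graph2_def using le_pair by auto

lemma delta_key: "trm M t1 \<Longrightarrow> trm M t2 \<Longrightarrow> delta_pred k (\<lambda>\<rho>. t1 \<rho> = key (t2 \<rho>))"
proof -
  assume t: "trm M t1" "trm M t2"
  have "delta_pred 0 (\<lambda>\<rho>. t1 \<rho> = key (t2 \<rho>))"
    unfolding key_iff by (intro delta_bex_le delta_conj delta_eq delta_mem trm_pair trm_var t t[THEN trm_ren] le0)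
  then show ?thesis by (rule delta_mono) simp
qed

text \<open>Whether the greedy construction, having selected the elements below \<open>x\<close> that satisfy \<open>r\<close>,
  selects \<open>x\<close>.\<close>

definition selects :: "('a \<Rightarrow> bool) \<Rightarrow> 'a \<Rightarrow> bool" where
  "selects r x \<longleftrightarrow>
    (\<exists>e. e \<preceq> x \<and> x = key e \<and> (\<forall>y. y \<prec> x \<longrightarrow> r y \<longrightarrow> y \<prec> e)) \<and>
    (\<forall>y. y \<prec> x \<longrightarrow> (\<forall>y'. y' \<prec> x \<longrightarrow> r y \<longrightarrow> r y' \<longrightarrow> y \<noteq> y' \<longrightarrow> \<not> eqc y x y' x)) \<and>
    (\<forall>y. y \<prec> x \<longrightarrow> (\<forall>y'. y' \<prec> x \<longrightarrow> (\<forall>t. t \<prec> x \<longrightarrow> r y \<longrightarrow> r y' \<longrightarrow> r t \<longrightarrow> \<not> eqc y x y' t)))"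

lemma selects_cong: "(\<And>y. y \<prec> x \<Longrightarrow> r y \<longleftrightarrow> r' y) \<Longrightarrow> selects r x \<longleftrightarrow> selects r' x"
  unfolding selects_def by (simp cong: conj_cong imp_cong)

lemma delta_selects:
  assumes t: "trm M t1" "trm M t2" "trm M t3"
  shows "delta_pred (Suc 0) (\<lambda>\<rho>. selects (coded (t1 \<rho>) (t2 \<rho>)) (t3 \<rho>))"
  unfolding selects_def
  by (intro delta_intros delta_key delta_eqc delta_coded trm_var t t[THEN trm_ren]
      t[THEN trm_ren, THEN trm_ren] t[THEN trm_ren, THEN trm_ren, THEN trm_ren]) simp_all

section \<open>The greedy recursion via coded approximations\<close>

definition approx :: "'a \<Rightarrow> 'a \<Rightarrow> 'a \<Rightarrow> bool" where
  "approx b a n \<longleftrightarrow> (\<forall>z. z \<preceq> n \<longrightarrow> (coded b a z \<longleftrightarrow> selects (coded b a) z))"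

lemma delta_approx:
  assumes t: "trm M t1" "trm M t2" "trm M t3"
  shows "delta_pred (Suc 0) (\<lambda>\<rho>. approx (t1 \<rho>) (t2 \<rho>) (t3 \<rho>))"
  unfolding approx_def
  by (intro delta_intros delta_selects delta_coded trm_var t t[THEN trm_ren]) simp_all

text \<open>Course-of-values recursion as an induction on the length. One \<open>b\<close> serves
  all stages up to \<open>n\<close>; the code \<open>a\<close> is replaced at each stage by one that
  also records the decision on \<open>m\<close>.\<close>

lemma approx_exists: "\<exists>b a. approx b a n"
proof -
  obtain b where b: "common_multiple (n \<oplus> \<one>) b" using common_multiple_exists by blast
  let ?P = "\<lambda>m. \<exists>a. m \<preceq> n \<oplus> \<one> \<longrightarrow> (\<forall>z. z \<prec> m \<longrightarrow> (coded b a z \<longleftrightarrow> selects (coded b a) z))"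
  have "?P (n \<oplus> \<one>)"
  proof (rule induct_2[where P = ?P])
    show "sigma M Z 2 (\<lambda>\<rho>. ?P (\<rho> 0))"
      unfolding numeral_2_eq_2
      by (intro sigma_Suc_ex_delta delta_intros delta_selects delta_coded trm_intros) simp_all
    show "?P \<zero>" by simp
    show "?P (m \<oplus> \<one>)" if "?P m" for m
    proof (cases "m \<prec> n \<oplus> \<one>")
      case False
      then show ?thesis unfolding Suc_le by blast
    next
      case True
      then obtain a where a: "\<And>z. z \<prec> m \<Longrightarrow> coded b a z \<longleftrightarrow> selects (coded b a) z"
        using \<open>?P m\<close> by (auto simp: le_def)
      have "delta_pred (Suc 0) (\<lambda>\<rho>. (\<rho> 0 \<prec> m \<and> coded b a (\<rho> 0)) \<or> (\<rho> 0 = m \<and> selects (coded b a) m))"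
        by (intro delta_intros delta_selects delta_coded trm_intros) simp_all
      then have "sigma M Z 2 (\<lambda>\<rho>. (\<rho> 0 \<prec> m \<and> coded b a (\<rho> 0)) \<or> (\<rho> 0 = m \<and> selects (coded b a) m))"
        by (intro sigma_delta) (rule delta_mono, assumption, simp)
      from bounded_comprehension[OF b this] obtain a' where
        a': "\<And>z. z \<prec> n \<oplus> \<one> \<Longrightarrow> coded b a' z \<longleftrightarrow> (z \<prec> m \<and> coded b a z) \<or> (z = m \<and> selects (coded b a) m)"
        by blast
      \<comment> \<open>The new code agrees with the old one below \<open>m\<close>, so by
        \<open>selects_cong\<close> all earlier decisions, and the one on \<open>m\<close>, are
        unaffected by the exchange.\<close>
      have same: "coded b a' z \<longleftrightarrow> coded b a z" if "z \<prec> m" for z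
        using a'[of z] that True less_trans by auto
      have "selects (coded b a') z \<longleftrightarrow> selects (coded b a) z" if "z \<preceq> m" for z
        by (rule selects_cong, rule same) (use that in order)
      moreover have "coded b a' m \<longleftrightarrow> selects (coded b a) m" using a'[OF True] by simp
      ultimately have "coded b a' z \<longleftrightarrow> selects (coded b a') z" if "z \<prec> m \<oplus> \<one>" for z
        using that a same unfolding less_Suc by (auto simp: le_def)
      then show ?thesis by blast
    qed
  qed
  then show ?thesis unfolding approx_def less_Suc_le by auto
qed

text \<open>At a least disagreement the two codes agree on everything smaller, which is all that
  \<open>selects\<close> looks at.\<close>

lemma approx_unique:
  assumes "approx b a n" "approx b' a' n" "z \<preceq> n" shows "coded b a z \<longleftrightarrow> coded b' a' z"
proof (rule ccontr)
  let ?P = "\<lambda>z. z \<preceq> n \<and> (coded b a z \<longleftrightarrow> \<not> coded b' a' z)"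
  assume "(coded b a z) \<noteq> (coded b' a' z)"
  with assms(3) have "?P z" by blast
  have "delta_pred 0 (\<lambda>\<rho>. ?P (\<rho> 0))" by (intro delta_intros delta_coded trm_intros) simp_all
  from least_number[OF _ sigma_not_delta[OF this] \<open>?P z\<close>]
  obtain m where m: "?P m" "\<And>x. x \<prec> m \<Longrightarrow> \<not> ?P x" by auto
  have "selects (coded b a) m \<longleftrightarrow> selects (coded b' a') m"
  proof (rule selects_cong)
    fix y assume "y \<prec> m"
    moreover have "y \<preceq> n" using \<open>y \<prec> m\<close> conjunct1[OF m(1)] by order
    ultimately show "coded b a y \<longleftrightarrow> coded b' a' y" using m(2) by blast
  qed
  with assms(1,2) m(1) show False unfolding approx_def by blast
qed

definition selected :: "'a set" where
  "selected = {x. \<exists>b a. approx b a x \<and> coded b a x}"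

text \<open>Existence and uniqueness of approximations give the complement a
  \<open>\<Sigma>\<^sub>1\<close> definition too, so \<open>selected\<close> is
  \<open>\<Delta>\<^sub>1\<close> in \<open>Z\<close>.\<close>

lemma not_selected_iff: "x \<notin> selected \<longleftrightarrow> (\<exists>b a. approx b a x \<and> \<not> coded b a x)"
proof -
  obtain b a where ba: "approx b a x" using approx_exists by blast
  have "coded b' a' x \<longleftrightarrow> coded b a x" if "approx b' a' x" for b' a'
    using approx_unique[OF that ba] by simp
  with ba show ?thesis unfolding selected_def by blast
qed

lemma selected_iff: "x \<in> selected \<longleftrightarrow> selects (\<lambda>y. y \<in> selected) x"
proof -
  obtain b a where ba: "approx b a x" using approx_exists by blast
  have "coded b a y \<longleftrightarrow> y \<in> selected" if "y \<preceq> x" for y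
  proof -
    have "approx b a y" using ba that unfolding approx_def by (meson order.trans)
    then show ?thesis using not_selected_iff unfolding selected_def by blast
  qed
  moreover from this have "selects (coded b a) x \<longleftrightarrow> selects (\<lambda>y. y \<in> selected) x"
    by (intro selects_cong) (simp add: le_def)
  ultimately show ?thesis using ba unfolding approx_def by simp
qed

lemma delta_selected: "delta_pred (Suc 0) (\<lambda>\<rho>. \<rho> i \<in> selected)"
  unfolding delta_pred_def not_selected_iff unfolding selected_def mem_Collect_eq
  by (intro conjI sigma_ex sigma_delta delta_intros delta_approx delta_coded trm_intros) simp_all

section \<open>Infinity and the rainbow property\<close>

lemma selectedE:
  assumes "x \<in> selected"
  obtains e where "x = key e" "\<And>y. y \<prec> x \<Longrightarrow> y \<in> selected \<Longrightarrow> y \<prec> e"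
  using assms unfolding selected_iff[of x] selects_def by blast

lemma selected_not_eqc:
  assumes "x \<in> selected" "y \<prec> x" "y' \<prec> x" "y \<in> selected" "y' \<in> selected"
  shows "y \<noteq> y' \<Longrightarrow> \<not> eqc y x y' x" and "t \<prec> x \<Longrightarrow> t \<in> selected \<Longrightarrow> \<not> eqc y x y' t"
  using assms unfolding selected_iff[of x] selects_def by blast+

lemma eqc_sym: "eqc x s y t \<longleftrightarrow> eqc y t x s"
  unfolding eqc_def by auto

lemma partner_sym: "partner x y \<longleftrightarrow> partner y x"
  unfolding partner_def by (metis eqc_sym)

text \<open>The larger of the two is \<open>key e\<close> for an \<open>e\<close> above the smaller
  one, so \<open>key_not_partner\<close> applies.\<close>

lemma selected_not_partner:
  assumes "y \<in> selected" "y' \<in> selected" "y \<noteq> y'" shows "\<not> partner y y'"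
  using assms
proof (induction y y' rule: linorder_wlog)
  case (le y y')
  then have "y \<prec> y'" by (simp add: le_def)
  then show ?case using le(2,3) selectedE key_not_partner partner_sym by metis
next
  case (sym y y')
  then show ?case using partner_sym by metis
qed

text \<open>If all selected numbers lie below \<open>d\<close>, each triple of numbers up to
  \<open>d\<close> forbids only boundedly many \<open>x\<close>: one color occurs on few pairs, and
  distinct selected numbers are not partners. Collection makes the bound uniform, and a
  \<open>key\<close> beyond it would have to be selected.\<close>

lemma selected_infinite: "\<not> finite_in M selected"
proof
  assume "finite_in M selected"
  then obtain d where d: "\<And>x. x \<in> selected \<Longrightarrow> x \<prec> d" unfolding finite_in_def by blast
  \<comment> \<open>The triple is passed as one code \<open>z\<close> because
    \<open>collection\<close> handles binary relations. Decoding by quantifiers bounded by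
    \<open>z\<close> keeps the matrix \<open>\<Delta>\<^sub>1\<close>; numbers that code no triple
    satisfy \<open>Q\<close> vacuously.\<close>
  define Q where "Q u z \<longleftrightarrow> (\<forall>x. u \<prec> x \<longrightarrow> (\<forall>y. y \<preceq> z \<longrightarrow> (\<forall>y'. y' \<preceq> z \<longrightarrow> (\<forall>t. t \<preceq> z \<longrightarrow>
    z = pair M (pair M y y') t \<longrightarrow> \<not> eqc y x y' t \<and>
    (y \<in> selected \<longrightarrow> y' \<in> selected \<longrightarrow> y \<noteq> y' \<longrightarrow> \<not> eqc y x y' x)))))" for u z
  have "sigma M Z (Suc (Suc 0)) (\<lambda>\<rho>. Q (\<rho> 0) (\<rho> (Suc 0)))"
    unfolding Q_def
    by (intro sigma_2_eventually delta_intros delta_eqc delta_selected trm_intros) simp_all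
  moreover have "\<exists>u. Q u z" for z
  proof (cases "\<exists>y y' t. z = pair M (pair M y y') t")
    case True
    then obtain y y' t where z: "z = pair M (pair M y y') t" by blast
    obtain u1 where u1: "\<And>x. u1 \<prec> x \<Longrightarrow> \<not> eqc y x y' t" using color_bounded by blast
    obtain u2 where u2: "\<And>x. u2 \<prec> x \<Longrightarrow> y \<in> selected \<Longrightarrow> y' \<in> selected \<Longrightarrow> y \<noteq> y' \<Longrightarrow> \<not> eqc y x y' x"
      using selected_not_partner[of y y'] not_partner_iff by blast
    have "Q (u1 \<oplus> u2) z"
      unfolding Q_def
    proof (intro allI impI)
      fix x v v' s assume "u1 \<oplus> u2 \<prec> x" "z = pair M (pair M v v') s"
      then have "v = y" "v' = y'" "s = t" unfolding z by simp_all
      moreover have "u1 \<prec> x" "u2 \<prec> x"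
        using \<open>u1 \<oplus> u2 \<prec> x\<close> le_plus[of u1 u2] le_plus[of u2 u1] by order+
      ultimately show "\<not> eqc v x v' s \<and> (v \<in> selected \<longrightarrow> v' \<in> selected \<longrightarrow> v \<noteq> v' \<longrightarrow> \<not> eqc v x v' x)"
        using u1 u2 by blast
    qed
    then show ?thesis by blast
  next
    case False
    then show ?thesis unfolding Q_def by blast
  qed
  ultimately obtain w where
    w: "\<And>z. z \<prec> pair M (pair M d d) d \<oplus> \<one> \<Longrightarrow> \<exists>u. u \<prec> w \<and> Q u z"
    using collection[of "Suc 0" Q] by (metis Nat.le_refl numeral_2_eq_2)
  \<comment> \<open>The summand \<open>w\<close> puts \<open>x\<close> beyond all exceptions; the
    summand \<open>d\<close> puts the index above every selected number and makes
    \<open>x \<preceq> y\<close> impossible to avoid for none of them, that is, \<open>x\<close> is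
    at least \<open>d\<close>.\<close>
  define x where "x = key (w \<oplus> d)"
  have x: "w \<preceq> x" "d \<preceq> x" using le_plus[of w d] le_plus[of d w] le_key[of "w \<oplus> d"] unfolding x_def by order+
  have Q: "\<not> eqc y x y' t \<and> (y \<noteq> y' \<longrightarrow> \<not> eqc y x y' x)"
    if "y \<in> selected" "y' \<in> selected" "t \<in> selected" for y y' t
  proof -
    have "pair M (pair M y y') t \<prec> pair M (pair M d d) d \<oplus> \<one>"
      unfolding less_Suc_le using d that by (intro pair_mono) (auto simp: le_def)
    from w[OF this] obtain u where u: "u \<prec> w" "Q u (pair M (pair M y y') t)" by blast
    have "u \<prec> x" using u(1) x(1) by order
    moreover have "y \<preceq> pair M (pair M y y') t" "y' \<preceq> pair M (pair M y y') t" "t \<preceq> pair M (pair M y y') t"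
      using le_pair order.trans by blast+
    ultimately show ?thesis using u(2) that unfolding Q_def by blast
  qed
  have "selects (\<lambda>y. y \<in> selected) x"
    unfolding selects_def
  proof (intro conjI)
    have "y \<prec> w \<oplus> d" if "y \<in> selected" for y using d[OF that] le_plus[of d w] by order
    then show "\<exists>e. e \<preceq> x \<and> x = key e \<and> (\<forall>y. y \<prec> x \<longrightarrow> y \<in> selected \<longrightarrow> y \<prec> e)"
      unfolding x_def using le_key by blast
  qed (use Q in blast)+
  then have "x \<prec> d" using d selected_iff by blast
  then show False using x(2) by order
qed

text \<open>Compare the larger entries of the two pairs. If they are equal, the first color
  condition of \<open>selects\<close> applies at that number; otherwise the second applies at the
  larger one, all other entries being smaller.\<close>

lemma rainbow_selected: "rainbow M f selected"
  unfolding rainbow_def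
proof (rule inj_onI, clarify)
  have *: "y = y' \<and> x = x'"
    if "y \<in> selected" "x \<in> selected" "y \<prec> x" "y' \<in> selected" "x' \<in> selected" "y' \<prec> x'" "f y x = f y' x'" "x' \<preceq> x"
    for y x y' x'
  proof (cases "x = x'")
    case True
    then show ?thesis using selected_not_eqc(1)[of x y y'] that unfolding eqc_def by blast
  next
    case False
    then have "x' \<prec> x" "y' \<prec> x" using that by order+
    then show ?thesis using selected_not_eqc(2)[of x y y' x'] that unfolding eqc_def by blast
  qed
  fix y x y' x' assume "(y, x) \<in> pairs_of M selected" "(y', x') \<in> pairs_of M selected" "f y x = f y' x'"
  then show "y = y' \<and> x = x'"
    using *[of y x y' x'] *[of y' x' y x] le_cases[of x x'] unfolding pairs_of_def by auto
qed

end

theorem lemma6p2: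
  fixes M :: "'a l2_struct" and f :: "'a \<Rightarrow> 'a \<Rightarrow> 'a"
  assumes "RCA0 M" and "Sigma_induction 2 M"
    and "computable_coloring M f"
    and "weakly_rainbow_stable M f"
    and "two_bounded M f"
  shows "\<exists>X :: 'a \<Rightarrow> 'a set. delta2_finite_family M X \<and>
    (\<forall>h :: 'a \<Rightarrow> 'a \<Rightarrow> 'a. graph2 M UNIV h \<in> sets M \<and> escaping M X h \<longrightarrow>
       (\<exists>R. computes M (graph2 M UNIV h) R \<and> \<not> finite_in M R \<and> rainbow M f R))"
proof -
  have coloring: "stable_coloring M Z f" if "Z \<in> sets M" for Z
    using assms that unfolding RCA0_def by unfold_locales auto
  have delta_inI: "delta_in k Z M A"
    if "arith_model M Z" "arith_model.delta_pred M Z k (\<lambda>\<rho>. \<rho> 0 \<in> A)" for k Z A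
  proof -
    have A: "sigma M Z k (\<lambda>\<rho>. \<rho> 0 \<in> A)" "sigma M Z k (\<lambda>\<rho>. \<rho> 0 \<notin> A)"
      using that(2) unfolding arith_model.delta_pred_def[OF that(1)] by auto
    show ?thesis unfolding delta_in_def
      using sigma_defset[OF A(1)] pi_defset[OF A(2)] by metis
  qed
  \<comment> \<open>The axioms only supply some set \<open>A\<close>. Comprehension relative to it
    yields the empty set, the oracle over which the lightface family is defined.\<close>
  obtain A where "A \<in> sets M" using assms(1) unfolding RCA0_def by blast
  then interpret any: stable_coloring M A f by (rule coloring)
  have "any.delta_pred 1 (\<lambda>\<rho>. \<rho> 0 \<in> {})" using any.delta_const[of 1 False] by simp
  then have "{} \<in> sets M" by (rule any.sets_of_delta[OF any.comprehension])
  then interpret empty: stable_coloring M "{}" f by (rule coloring)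
  have "delta2_finite_family M empty.partner_family"
    unfolding delta2_finite_family_def
    by (intro conjI allI empty.finite_partner_family delta_inI empty.arith_model_axioms empty.delta_partner_family)
  moreover have "\<exists>R. computes M (graph2 M UNIV h) R \<and> \<not> finite_in M R \<and> rainbow M f R"
    if h: "graph2 M UNIV h \<in> sets M" "escaping M empty.partner_family h" for h
  proof -
    interpret H: stable_coloring M "graph2 M UNIV h" f using h(1) by (rule coloring)
    \<comment> \<open>\<open>partner_family\<close> is defined from \<open>f\<close> alone and does
      not change with the oracle, so a single family serves all escaping functions.\<close>
    have "H.partner_family = empty.partner_family" by simp
    then interpret H: escaping_function M "graph2 M UNIV h" f h
      by unfold_locales (use h(2) in simp_all)
    have "computes M (graph2 M UNIV h) H.selected"
      unfolding computes_def using H.delta_selected by (intro delta_inI H.arith_model_axioms) simp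
    then show ?thesis using H.selected_infinite H.rainbow_selected by blast
  qed
  ultimately show ?thesis by blast
qed

end
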